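(* Run PR-SGD-Momentum with Option I (Polyak's momentum; defined in the context) with momentum coefficient $\beta\in[0,1)$, learning rate $\gamma>0$ and synchronization interval $I$ (a positive integer) on the problem $\min_{\mathbf{x}\in\mathbb{R}^m} f(\mathbf{x})$ satisfying Assumption A (see context), and let $f^\ast$ be the minimum value of $f$. If $\gamma \le \frac{(1-\beta)^2}{(1+\beta)L}$ and $I\le \frac{1-\beta}{6L\gamma}$, then for all $T\ge 1$, $$\frac1T\sum_{t=0}^{T-1}\mathbb{E}\big[\|\nabla f(\bar{\mathbf{x}}^{(t)})\|^2\big]\le \frac{2(1-\beta)}{\gamma T}\big(f(\bar{\mathbf{x}}^{(0)})-f^\ast\big)+\frac{L\gamma}{(1-\beta)^2}\frac{\sigma^2}{N}+\frac{4L^2\gamma^2 I\sigma^2}{(1-\beta)^2}+\frac{9L^2\gamma^2I^2\kappa^2}{(1-\beta)^2},$$ and the right-hand side is $O(\frac{1}{\gamma T})+O(\frac{\gamma}{N}\sigma^2)+O(\gamma^2 I\sigma^2)+O(\gamma^2I^2\kappa^2)$.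
   Context: Setting. $N,m\ge1$ are integers. For $i\in\{1,\dots,N\}$, $\mathcal{D}_i$ is a probability distribution, $F_i(\mathbf{x};\xi)$ is a real-valued function differentiable in $\mathbf{x}\in\mathbb{R}^m$, $f_i(\mathbf{x})=\mathbb{E}_{\xi\sim\mathcal{D}_i}[F_i(\mathbf{x};\xi)]$, and $f=\frac1N\sum_{i=1}^N f_i$. Stochastic gradients are unbiased: $\mathbb{E}_{\xi\sim\mathcal{D}_i}[\nabla F_i(\mathbf{x};\xi)]=\nabla f_i(\mathbf{x})$. $\|\cdot\|$ is the Euclidean norm. Assumption A. (1) Each $f_i$ is smooth with modulus $L>0$, i.e. differentiable with $L$-Lipschitz gradient. (2) There are constants $\sigma>0$, $\kappa>0$ with $\mathbb{E}_{\xi\sim\mathcal{D}_i}[\|\nabla F_i(\mathbf{x};\xi)-\nabla f_i(\mathbf{x})\|^2]\le\sigma^2$ for all $i,\mathbf{x}$, and $\frac1N\sum_{i=1}^N\|\nabla f_i(\mathbf{x})-\nabla f(\mathbf{x})\|^2\le\kappa^2$ for all $\mathbf{x}$. PR-SGD-Momentum, Option I. Initialize $\mathbf{x}_i^{(0)}=\hat{\mathbf{x}}\in\mathbb{R}^m$ (the same deterministic point for all $i$) and $\mathbf{u}_i^{(0)}=\mathbf{0}$. For $t=1,2,\dots$: each worker $i$ draws $\xi_i^{(t-1)}\sim\mathcal{D}_i$ (independently over workers and iterations), sets $\mathbf{g}_i^{(t-1)}=\nabla F_i(\mathbf{x}_i^{(t-1)};\xi_i^{(t-1)})$, and updates $\mathbf{u}_i^{(t)}=\beta\mathbf{u}_i^{(t-1)}+\mathbf{g}_i^{(t-1)}$,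 $\mathbf{x}_i^{(t)}=\mathbf{x}_i^{(t-1)}-\gamma\mathbf{u}_i^{(t)}$. If $t$ is a multiple of $I$, then all workers reset $\mathbf{u}_i^{(t)}$ to $\frac1N\sum_{j=1}^N\mathbf{u}_j^{(t)}$ and $\mathbf{x}_i^{(t)}$ to $\frac1N\sum_{j=1}^N\mathbf{x}_j^{(t)}$. Denote $\bar{\mathbf{x}}^{(t)}=\frac1N\sum_{i=1}^N\mathbf{x}_i^{(t)}$. In the $O(\cdot)$ expression the hidden constants depend only on $L$, $\beta$ and $f(\bar{\mathbf{x}}^{(0)})-f^\ast$. *)

theory Defs
  imports "HOL-Probability.Probability" "HOL-Library.Landau_Symbols"
begin

definition gradient :: "('a::real_inner \<Rightarrow> real) \<Rightarrow> 'a \<Rightarrow> 'a" where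
  "gradient f x = (THE D. GDERIV f x :> D)"

lemma gradient_eqI:
  assumes "GDERIV f x :> D"
  shows "gradient f x = D"
  unfolding gradient_def
proof (rule the_equality)
  fix D' assume "GDERIV f x :> D'"
  with assms have "(\<lambda>h. h \<bullet> D') = (\<lambda>h. h \<bullet> D)"
    unfolding gderiv_def by (rule has_derivative_unique[rotated])
  then have "\<forall>h. h \<bullet> D' = h \<bullet> D"
    by (rule fun_cong[THEN allI])
  then show "D' = D"
    by (simp only: vector_eq_ldot)
qed (rule assms)

definition average :: "nat \<Rightarrow> (nat \<Rightarrow> 'a::real_vector) \<Rightarrow> 'a" where
  "average N v = (\<Sum>i=1..N. v i) /\<^sub>R real N"

text \<open>\<open>F i x \<xi>\<close> is the loss of worker \<open>i\<close> at the point \<open>x\<close> on the sample \<open>\<xi>\<close>.\<close>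

definition local_objective ::
  "(nat \<Rightarrow> 'd measure) \<Rightarrow> (nat \<Rightarrow> 'a \<Rightarrow> 'd \<Rightarrow> real) \<Rightarrow> nat \<Rightarrow> 'a \<Rightarrow> real" where
  "local_objective D F i x = (\<integral>\<xi>. F i x \<xi> \<partial>(D i))"

definition global_objective ::
  "nat \<Rightarrow> (nat \<Rightarrow> 'd measure) \<Rightarrow> (nat \<Rightarrow> 'a \<Rightarrow> 'd \<Rightarrow> real) \<Rightarrow> 'a \<Rightarrow> real" where
  "global_objective N D F x = average N (\<lambda>i. local_objective D F i x)"

text \<open>
  The state after \<open>t\<close> iterations is the pair of the momentum buffers \<open>u\<close> and the iterates \<open>x\<close>,
  both indexed by the worker. The argument \<open>s\<close> is one realisation of all samples: \<open>s t i\<close> is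
  the sample that worker \<open>i\<close> uses in passing from iteration \<open>t\<close> to iteration \<open>Suc t\<close>.
\<close>

primrec sgdm_state ::
  "nat \<Rightarrow> (nat \<Rightarrow> 'a::real_inner \<Rightarrow> 'd \<Rightarrow> real) \<Rightarrow> real \<Rightarrow> real \<Rightarrow> nat \<Rightarrow> 'a \<Rightarrow>
    (nat \<Rightarrow> nat \<Rightarrow> 'd) \<Rightarrow> nat \<Rightarrow> (nat \<Rightarrow> 'a) \<times> (nat \<Rightarrow> 'a)" where
  "sgdm_state N F \<beta> \<gamma> I x0 s 0 = (\<lambda>i. 0, \<lambda>i. x0)"
| "sgdm_state N F \<beta> \<gamma> I x0 s (Suc t) =
    (let (u, x) = sgdm_state N F \<beta> \<gamma> I x0 s t;
         g = (\<lambda>i. gradient (\<lambda>y. F i y (s t i)) (x i));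
         u' = (\<lambda>i. \<beta> *\<^sub>R u i + g i);
         x' = (\<lambda>i. x i - \<gamma> *\<^sub>R u' i)
     in if I dvd Suc t then (\<lambda>i. average N u', \<lambda>i. average N x') else (u', x'))"

definition mean_iterate ::
  "nat \<Rightarrow> (nat \<Rightarrow> 'a::real_inner \<Rightarrow> 'd \<Rightarrow> real) \<Rightarrow> real \<Rightarrow> real \<Rightarrow> nat \<Rightarrow> 'a \<Rightarrow>
    (nat \<Rightarrow> nat \<Rightarrow> 'd) \<Rightarrow> nat \<Rightarrow> 'a" where
  "mean_iterate N F \<beta> \<gamma> I x0 s t = average N (snd (sgdm_state N F \<beta> \<gamma> I x0 s t))"

lemma mean_iterate_0:
  assumes "1 \<le> N"
  shows "mean_iterate N F \<beta> \<gamma> I x0 s 0 = x0"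
proof -
  have "(\<Sum>i=1..N. x0) = real N *\<^sub>R x0"
    by (simp add: scaleR_conv_of_real sum_constant_scaleR)
  then show ?thesis
    using assms by (simp add: mean_iterate_def average_def)
qed

text \<open>The argument \<open>\<Delta>\<close> stands for the initial optimality gap.\<close>

definition sgdm_bound ::
  "real \<Rightarrow> real \<Rightarrow> real \<Rightarrow> nat \<Rightarrow> nat \<Rightarrow> nat \<Rightarrow> real \<Rightarrow> real \<Rightarrow> real \<Rightarrow> real" where
  "sgdm_bound L \<beta> \<Delta> N T I \<gamma> \<sigma> \<kappa> =
     2 * (1 - \<beta>) / (\<gamma> * real T) * \<Delta>
     + L * \<gamma> / (1 - \<beta>)\<^sup>2 * (\<sigma>\<^sup>2 / real N)
     + 4 * L\<^sup>2 * \<gamma>\<^sup>2 * real I * \<sigma>\<^sup>2 / (1 - \<beta>)\<^sup>2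
     + 9 * L\<^sup>2 * \<gamma>\<^sup>2 * (real I)\<^sup>2 * \<kappa>\<^sup>2 / (1 - \<beta>)\<^sup>2"

definition admissible_params :: "real \<Rightarrow> real \<Rightarrow> (nat \<times> nat \<times> nat \<times> real \<times> real \<times> real) set" where
  "admissible_params L \<beta> = {(N, T, I, \<gamma>, \<sigma>, \<kappa>).
     1 \<le> N \<and> 1 \<le> T \<and> 1 \<le> I \<and> 0 < \<gamma> \<and> 0 < \<sigma> \<and> 0 < \<kappa> \<and>
     \<gamma> \<le> (1 - \<beta>)\<^sup>2 / ((1 + \<beta>) * L) \<and> real I \<le> (1 - \<beta>) / (6 * L * \<gamma>)}"

text \<open>
  A sum of \<open>O\<close>-terms in several parameters is read as a decomposition into four functions of
  these parameters. On the principal filter of \<open>admissible_params L \<beta>\<close>, membership in \<open>O\<close> means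
  that one constant works for all admissible parameters, so the constants depend on
  \<open>L\<close>, \<open>\<beta>\<close>, \<open>\<Delta>\<close> only.
\<close>

definition sgdm_bound_rate :: "real \<Rightarrow> real \<Rightarrow> real \<Rightarrow> bool" where
  "sgdm_bound_rate L \<beta> \<Delta> \<longleftrightarrow> (let P = principal (admissible_params L \<beta>) in
     \<exists>h1 h2 h3 h4.
       (\<forall>(N, T, I, \<gamma>, \<sigma>, \<kappa>) \<in> admissible_params L \<beta>. sgdm_bound L \<beta> \<Delta> N T I \<gamma> \<sigma> \<kappa> =
          h1 (N, T, I, \<gamma>, \<sigma>, \<kappa>) + h2 (N, T, I, \<gamma>, \<sigma>, \<kappa>) +
          h3 (N, T, I, \<gamma>, \<sigma>, \<kappa>) + h4 (N, T, I, \<gamma>, \<sigma>, \<kappa>)) \<and>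
       h1 \<in> O[P](\<lambda>(N, T, I, \<gamma>, \<sigma>, \<kappa>). 1 / (\<gamma> * real T)) \<and>
       h2 \<in> O[P](\<lambda>(N, T, I, \<gamma>, \<sigma>, \<kappa>). \<gamma> / real N * \<sigma>\<^sup>2) \<and>
       h3 \<in> O[P](\<lambda>(N, T, I, \<gamma>, \<sigma>, \<kappa>). \<gamma>\<^sup>2 * real I * \<sigma>\<^sup>2) \<and>
       h4 \<in> O[P](\<lambda>(N, T, I, \<gamma>, \<sigma>, \<kappa>). \<gamma>\<^sup>2 * (real I)\<^sup>2 * \<kappa>\<^sup>2))"

end

theory Submission
  imports Defs
begin

text \<open>
  Averaging over the workers commutes with the update rule, so the mean momentum and the mean
  iterate follow ordinary momentum descent driven by the mean stochastic gradient, whether or not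
  a synchronization happens. With \<open>z = xbar - \<beta> \<gamma> / (1 - \<beta>) ubar\<close> this becomes plain gradient
  descent, \<open>z\<close> moving by \<open>- \<gamma> / (1 - \<beta>)\<close> times the mean stochastic gradient. Summing the descent
  inequality of the smooth objective along \<open>z\<close> (\<open>sum_descent\<close>) and taking expectations leaves three
  discrepancies, each controlled separately.

  First, the gradient is taken at \<open>z\<close> instead of the mean iterate. The gap between the two is a
  multiple of the mean momentum, whose energy is at most \<open>1 / (1 - \<beta>)\<^sup>2\<close> times that of the mean
  stochastic gradients (\<open>sum_norm_ubar_square_le\<close>). The resulting multiple of the squared
  mean gradient is absorbed by the negative term of the descent inequality; the step size condition
  is exactly what makes the net coefficient nonpositive (\<open>combine_sgdm_bounds\<close>).

  Second, the stochastic gradients are noisy. The error of worker \<open>i\<close> at time \<open>t\<close> is orthogonal in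
  \<open>L\<^sup>2\<close> to everything determined by the other samples (\<open>noise_orthogonal\<close>). Hence errors of
  distinct workers or distinct times are uncorrelated, and averaging over workers divides the
  variance by \<open>N\<close>, which is the source of the linear speedup.

  Third, the workers evaluate gradients at their own iterates instead of the mean. Since a
  synchronization, a deviation is a weighted sum of at most \<open>I\<close> gradient deviations with weights
  at most \<open>1 / (1 - \<beta>)\<close>. Its noise part grows only like \<open>I\<close> because it is an orthogonal sum; the
  rest is bounded by Cauchy-Schwarz through the dissimilarity \<open>\<kappa>\<close> and the earlier deviations
  themselves. Under the condition on \<open>I\<close> the feedback factor is small, and strong induction
  gives a bound uniform in time (\<open>expectation_consensus_error_le\<close>).

  All expectations make sense because the iterates are measurable and square integrable; the former
  rests on joint measurability of the stochastic gradient in the point and the sample.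
\<close>

section \<open>Averages\<close>

lemma average_cong: "(\<And>i. i \<in> {1..N} \<Longrightarrow> v i = w i) \<Longrightarrow> average N v = average N w"
  by (simp add: average_def)

lemma average_const: "1 \<le> N \<Longrightarrow> average N (\<lambda>i. c) = c"
  by (simp add: average_def sum_constant_scaleR)

lemma average_add: "average N (\<lambda>i. v i + w i) = average N v + average N w"
  by (simp add: average_def sum.distrib scaleR_add_right)

lemma average_diff: "average N (\<lambda>i. v i - w i) = average N v - average N w"
  by (simp add: average_def sum_subtractf scaleR_diff_right)

lemma average_scaleR: "average N (\<lambda>i. c *\<^sub>R v i) = c *\<^sub>R average N v"
  by (simp add: average_def scaleR_sum_right mult.commute)

lemma average_mult: "average N (\<lambda>i. c * v i) = (c::real) * average N v"
  using average_scaleR[of N c v] by simp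

lemma average_sum: "average N (\<lambda>i. \<Sum>k\<in>K. v k i) = (\<Sum>k\<in>K. average N (v k))"
  unfolding average_def by (subst sum.swap) (simp add: scaleR_sum_right)

lemma average_inner: "average N (\<lambda>i. y \<bullet> v i) = y \<bullet> average N v"
  by (simp add: average_def inner_sum_right)

lemma average_mono:
  assumes "\<And>i. i \<in> {1..N} \<Longrightarrow> v i \<le> (w i :: real)"
  shows "average N v \<le> average N w"
  unfolding average_def using assms by (intro scaleR_left_mono sum_mono) auto

lemma average_nonneg:
  assumes "\<And>i. i \<in> {1..N} \<Longrightarrow> 0 \<le> (v i :: real)"
  shows "0 \<le> average N v"
  unfolding average_def using assms by (intro scaleR_nonneg_nonneg sum_nonneg) auto

text \<open>
  The bias-variance decomposition: the cross term vanishes since deviations from the mean average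
  to zero. It yields both that the mean minimizes the average squared deviation and Jensen's
  inequality for the squared norm.
\<close>
lemma average_square_deviation:
  fixes v :: "nat \<Rightarrow> 'a::real_inner"
  assumes "1 \<le> N"
  shows "average N (\<lambda>i. (norm (v i - a))\<^sup>2) =
    average N (\<lambda>i. (norm (v i - average N v))\<^sup>2) + (norm (average N v - a))\<^sup>2"
proof -
  define m where "m = average N v"
  have "average N (\<lambda>i. (norm (v i - a))\<^sup>2) =
      average N (\<lambda>i. (norm (v i - m))\<^sup>2 + (2 * ((m - a) \<bullet> (v i - m)) + (norm (m - a))\<^sup>2))"
    by (rule average_cong) (simp add: power2_norm_eq_inner inner_commute algebra_simps)
  also have "\<dots> = average N (\<lambda>i. (norm (v i - m))\<^sup>2) + (2 * ((m - a) \<bullet> (m - m)) + (norm (m - a))\<^sup>2)"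
    using assms
    by (simp only: average_add average_mult average_inner average_diff average_const m_def)
  finally show ?thesis
    by (simp add: m_def)
qed

lemma average_square_deviation_le:
  fixes v :: "nat \<Rightarrow> 'a::real_inner"
  assumes "1 \<le> N"
  shows "average N (\<lambda>i. (norm (v i - average N v))\<^sup>2) \<le> average N (\<lambda>i. (norm (v i - a))\<^sup>2)"
  using average_square_deviation[OF assms, of v a] by simp

lemma norm_average_square_le:
  fixes v :: "nat \<Rightarrow> 'a::real_inner"
  assumes "1 \<le> N"
  shows "(norm (average N v))\<^sup>2 \<le> average N (\<lambda>i. (norm (v i))\<^sup>2)"
  using average_square_deviation[OF assms, of v 0]
  by (simp add: average_nonneg)

lemma norm_add_square_le:
  fixes x y :: "'a::real_inner"
  shows "(norm (x + y))\<^sup>2 \<le> 2 * (norm x)\<^sup>2 + 2 * (norm y)\<^sup>2"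
proof -
  have "0 \<le> (norm (x - y))\<^sup>2" by simp
  then show ?thesis
    by (simp add: power2_norm_eq_inner inner_commute algebra_simps)
qed

lemma norm_sum_square_le:
  fixes v :: "'k \<Rightarrow> 'a::real_inner"
  assumes "finite K"
  shows "(norm (\<Sum>k\<in>K. v k))\<^sup>2 \<le> real (card K) * (\<Sum>k\<in>K. (norm (v k))\<^sup>2)"
proof -
  have "(norm (\<Sum>k\<in>K. v k))\<^sup>2 \<le> (\<Sum>k\<in>K. norm (v k))\<^sup>2"
    by (intro power_mono norm_sum) auto
  also have "\<dots> \<le> real (card K) * (\<Sum>k\<in>K. (norm (v k))\<^sup>2)"
    using Cauchy_Schwarz_ineq_sum[of "\<lambda>_. 1" "\<lambda>k. norm (v k)" K] by simp
  finally show ?thesis .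
qed

section \<open>Gradients and smoothness\<close>

text \<open>The Riesz representative of the derivative is the adjoint applied to \<open>1\<close>.\<close>
lemma GDERIV_gradient:
  fixes f :: "'a::euclidean_space \<Rightarrow> real"
  assumes "f differentiable (at x)"
  shows "GDERIV f x :> gradient f x"
proof -
  obtain f' where f': "(f has_derivative f') (at x)"
    using assms by (auto simp: differentiable_def)
  have lin: "linear f'"
    using f' by (rule has_derivative_linear)
  have "f' = (\<lambda>h. h \<bullet> adjoint f' 1)"
    using adjoint_works[OF lin] by (simp add: fun_eq_iff)
  with f' have "GDERIV f x :> adjoint f' 1"
    unfolding gderiv_def by metis
  then show ?thesis
    using gradient_eqI by metis
qed

lemma GDERIV_average:
  assumes "\<And>i. i \<in> {1..N} \<Longrightarrow> GDERIV (f i) x :> D i"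
  shows "GDERIV (\<lambda>y. average N (\<lambda>i. f i y)) x :> average N D"
proof -
  have "((\<lambda>y. (\<Sum>i=1..N. f i y) /\<^sub>R real N) has_derivative (\<lambda>h. (\<Sum>i=1..N. h \<bullet> D i) /\<^sub>R real N)) (at x)"
    using assms unfolding gderiv_def
    by (intro has_derivative_scaleR_right has_derivative_sum) auto
  then show ?thesis
    by (simp add: gderiv_def average_def inner_sum_right)
qed

lemma lipschitz_on_average:
  fixes h :: "nat \<Rightarrow> 'a::metric_space \<Rightarrow> 'b::real_normed_vector"
  assumes "1 \<le> N" and "0 \<le> L" and "\<And>i. i \<in> {1..N} \<Longrightarrow> L-lipschitz_on S (h i)"
  shows "L-lipschitz_on S (\<lambda>x. average N (\<lambda>i. h i x))"
proof (rule lipschitz_onI)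
  fix x y assume xy: "x \<in> S" "y \<in> S"
  have "norm (\<Sum>i=1..N. h i x - h i y) \<le> (\<Sum>i=1..N. L * dist x y)"
    using assms(3) xy
    by (intro sum_norm_le) (auto simp flip: dist_norm intro: lipschitz_onD)
  then have "norm (average N (\<lambda>i. h i x - h i y)) \<le> L * dist x y"
    using assms(1) by (simp add: average_def field_simps)
  then show "dist (average N (\<lambda>i. h i x)) (average N (\<lambda>i. h i y)) \<le> L * dist x y"
    by (simp add: dist_norm average_diff)
qed fact

lemma GDERIV_along_line:
  assumes "GDERIV f (x + t *\<^sub>R d) :> D"
  shows "((\<lambda>t. f (x + t *\<^sub>R d)) has_real_derivative D \<bullet> d) (at t)"
proof -
  have "((\<lambda>t. x + t *\<^sub>R d) has_derivative (\<lambda>h. h *\<^sub>R d)) (at t)"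
    by (auto intro!: derivative_eq_intros)
  from has_derivative_compose[OF this assms[unfolded gderiv_def]]
  show ?thesis
    by (simp add: has_field_derivative_def mult_commute_abs inner_commute)
qed

text \<open>
  Along the segment from \<open>x\<close> to \<open>x + d\<close>, the difference of the two sides has nonpositive derivative
  by the Lipschitz condition; monotonicity takes the place of integrating the gradient.
\<close>
lemma descent_lemma:
  fixes f :: "'a::euclidean_space \<Rightarrow> real"
  assumes grad: "\<And>x. GDERIV f x :> f' x" and lip: "L-lipschitz_on UNIV f'"
  shows "f (x + d) \<le> f x + f' x \<bullet> d + L / 2 * (norm d)\<^sup>2"
proof -
  define \<phi> where "\<phi> t = f (x + t *\<^sub>R d) - t * (f' x \<bullet> d) - L / 2 * t\<^sup>2 * (norm d)\<^sup>2" for t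
  have "\<phi> 1 \<le> \<phi> 0"
  proof (rule DERIV_nonpos_imp_nonincreasing[of 0 1 \<phi>])
    fix t :: real assume t: "0 \<le> t" "t \<le> 1"
    have "(\<phi> has_real_derivative f' (x + t *\<^sub>R d) \<bullet> d - f' x \<bullet> d - L * t * (norm d)\<^sup>2) (at t)"
      unfolding \<phi>_def
      by (rule derivative_eq_intros GDERIV_along_line[OF grad] refl | simp)+
    moreover have "f' (x + t *\<^sub>R d) \<bullet> d - f' x \<bullet> d \<le> L * t * (norm d)\<^sup>2"
    proof -
      have "f' (x + t *\<^sub>R d) \<bullet> d - f' x \<bullet> d \<le> norm (f' (x + t *\<^sub>R d) - f' x) * norm d"
        by (metis inner_diff_left norm_cauchy_schwarz)
      also have "\<dots> \<le> (L * dist (x + t *\<^sub>R d) x) * norm d"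
        using lipschitz_onD[OF lip, of "x + t *\<^sub>R d" x]
        by (intro mult_right_mono) (auto simp: dist_norm)
      finally show ?thesis
        using t by (simp add: dist_norm power2_eq_square algebra_simps)
    qed
    ultimately show "\<exists>y. (\<phi> has_real_derivative y) (at t) \<and> y \<le> 0"
      by (intro exI conjI) auto
  qed simp
  then show ?thesis
    by (simp add: \<phi>_def)
qed

section \<open>Joint measurability of stochastic gradients\<close>

text \<open>
  Caratheodory functions are jointly measurable: replace the first argument by simple functions
  converging to the identity. Each of these takes finitely many values, and continuity passes to
  the limit.
\<close>
lemma measurable_continuous_fst_measurable_snd:
  fixes F :: "'a::euclidean_space \<Rightarrow> 'd \<Rightarrow> real"
  assumes meas: "\<And>x. F x \<in> borel_measurable D"
    and cont: "\<And>z. z \<in> space D \<Longrightarrow> continuous_on UNIV (\<lambda>x. F x z)"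
  shows "(\<lambda>(x, z). F x z) \<in> borel_measurable (borel \<Otimes>\<^sub>M D)"
proof -
  have "(\<lambda>x::'a. x) \<in> borel_measurable borel" by simp
  then obtain \<phi> where simple: "\<And>n. simple_function borel (\<phi> n)"
    and lim: "\<And>x::'a. (\<lambda>n. \<phi> n x) \<longlonglongrightarrow> x"
    using borel_measurable_implies_sequence_metric[of "\<lambda>x::'a. x" borel 0] by auto
  show ?thesis
  proof (rule borel_measurable_LIMSEQ_metric[where f = "\<lambda>n p. F (\<phi> n (fst p)) (snd p)"])
    fix n
    have "\<phi> n \<in> measurable borel (count_space (range (\<phi> n)))"
      using simple_functionD[OF simple[of n]] by (simp add: measurable_count_space_eq2)
    then have "(\<lambda>p. \<phi> n (fst p)) \<in> measurable (borel \<Otimes>\<^sub>M D) (count_space (range (\<phi> n)))"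
      by measurable
    moreover have "countable (range (\<phi> n))"
      using simple_functionD(1)[OF simple[of n]] by (simp add: countable_finite)
    ultimately show "(\<lambda>p. F (\<phi> n (fst p)) (snd p)) \<in> borel_measurable (borel \<Otimes>\<^sub>M D)"
      using meas
      by (intro measurable_compose_countable'[where f = "\<lambda>x p. F x (snd p)"
            and g = "\<lambda>p. \<phi> n (fst p)" and I = "range (\<phi> n)"] measurable_compose[OF measurable_snd])
  next
    fix p assume "p \<in> space ((borel :: 'a measure) \<Otimes>\<^sub>M D)"
    then have "snd p \<in> space D" by (auto simp: space_pair_measure)
    then have "isCont (\<lambda>x. F x (snd p)) (fst p)"
      using cont continuous_on_eq_continuous_at by blast
    then show "(\<lambda>n. F (\<phi> n (fst p)) (snd p)) \<longlonglongrightarrow> (case p of (x, z) \<Rightarrow> F x z)"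
      using lim isCont_tendsto_compose by (fastforce simp: case_prod_beta)
  qed
qed

lemma GDERIV_difference_quotients:
  assumes "GDERIV f x :> D"
  shows "(\<lambda>n. (f (x + (1 / real (Suc n)) *\<^sub>R b) - f x) / (1 / real (Suc n))) \<longlonglongrightarrow> D \<bullet> b"
proof -
  have "((\<lambda>t. f (x + t *\<^sub>R b)) has_real_derivative D \<bullet> b) (at 0)"
    using assms by (intro GDERIV_along_line) simp
  then have *: "(\<lambda>h. (f (x + h *\<^sub>R b) - f x) / h) \<midarrow>0\<rightarrow> D \<bullet> b"
    by (simp add: DERIV_def)
  have "filterlim (\<lambda>n. 1 / real (Suc n)) (at 0) sequentially"
    using LIMSEQ_inverse_real_of_nat
    by (intro filterlim_atI) (auto simp: inverse_eq_divide)
  from filterlim_compose[OF * this] show ?thesis .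
qed

text \<open>
  Each coordinate of the gradient is a limit of difference quotients, and these are jointly
  measurable.
\<close>
lemma borel_measurable_gradient:
  fixes F :: "'a::euclidean_space \<Rightarrow> 'd \<Rightarrow> real"
  assumes meas: "\<And>x. F x \<in> borel_measurable D"
    and diff: "\<And>x z. z \<in> space D \<Longrightarrow> (\<lambda>y. F y z) differentiable (at x)"
  shows "(\<lambda>(x, z). gradient (\<lambda>y. F y z) x) \<in> borel_measurable (borel \<Otimes>\<^sub>M D)"
proof (subst borel_measurable_euclidean_space, rule ballI)
  fix b :: 'a assume "b \<in> Basis"
  have [measurable]: "(\<lambda>(x, z). F x z) \<in> borel_measurable (borel \<Otimes>\<^sub>M D)"
    using meas diff
    by (intro measurable_continuous_fst_measurable_snd)
      (auto simp: continuous_on_eq_continuous_within intro: differentiable_imp_continuous_within)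
  have "(\<lambda>p. F (fst p + (1 / real (Suc n)) *\<^sub>R b) (snd p)) \<in> borel_measurable (borel \<Otimes>\<^sub>M D)" for n
  proof -
    have "(\<lambda>p. (fst p + (1 / real (Suc n)) *\<^sub>R b, snd p)) \<in> (borel \<Otimes>\<^sub>M D) \<rightarrow>\<^sub>M (borel \<Otimes>\<^sub>M D)"
      by measurable
    then have "(\<lambda>p. (\<lambda>(x, z). F x z) (fst p + (1 / real (Suc n)) *\<^sub>R b, snd p)) \<in> borel_measurable (borel \<Otimes>\<^sub>M D)"
      by measurable
    then show ?thesis by simp
  qed
  note [measurable] = this
  have [measurable]: "(\<lambda>p. F (fst p) (snd p)) \<in> borel_measurable (borel \<Otimes>\<^sub>M D)"
    using \<open>(\<lambda>(x, z). F x z) \<in> borel_measurable (borel \<Otimes>\<^sub>M D)\<close> by (simp add: case_prod_beta')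
  show "(\<lambda>p. (case p of (x, z) \<Rightarrow> gradient (\<lambda>y. F y z) x) \<bullet> b) \<in> borel_measurable (borel \<Otimes>\<^sub>M D)"
  proof (rule borel_measurable_LIMSEQ_metric
      [where f = "\<lambda>n p. (F (fst p + (1 / real (Suc n)) *\<^sub>R b) (snd p) - F (fst p) (snd p)) / (1 / real (Suc n))"])
    fix p assume "p \<in> space ((borel :: 'a measure) \<Otimes>\<^sub>M D)"
    then have "snd p \<in> space D" by (auto simp: space_pair_measure)
    then show "(\<lambda>n. (F (fst p + (1 / real (Suc n)) *\<^sub>R b) (snd p) - F (fst p) (snd p)) / (1 / real (Suc n)))
        \<longlonglongrightarrow> (case p of (x, z) \<Rightarrow> gradient (\<lambda>y. F y z) x) \<bullet> b"
      using GDERIV_difference_quotients[OF GDERIV_gradient[OF diff]] by (simp add: case_prod_beta)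
  qed measurable
qed

section \<open>Square-integrable random vectors\<close>

definition square_integrable :: "'w measure \<Rightarrow> ('w \<Rightarrow> 'a::euclidean_space) \<Rightarrow> bool" where
  "square_integrable M X \<longleftrightarrow> X \<in> borel_measurable M \<and> integrable M (\<lambda>\<omega>. (norm (X \<omega>))\<^sup>2)"

lemma square_integrable_measurable [measurable_dest]:
  "square_integrable M X \<Longrightarrow> X \<in> borel_measurable M"
  by (simp add: square_integrable_def)

lemma square_integrable_norm_square:
  "square_integrable M X \<Longrightarrow> integrable M (\<lambda>\<omega>. (norm (X \<omega>))\<^sup>2)"
  by (simp add: square_integrable_def)

lemma square_integrable_bound:
  assumes "X \<in> borel_measurable M" and "integrable M B"
    and "\<And>\<omega>. (norm (X \<omega>))\<^sup>2 \<le> B \<omega>"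
  shows "square_integrable M X"
  unfolding square_integrable_def
proof
  show "integrable M (\<lambda>\<omega>. (norm (X \<omega>))\<^sup>2)"
    using assms(1,3) by (intro Bochner_Integration.integrable_bound[OF assms(2)])
      (auto intro: order_trans[OF _ abs_ge_self])
qed (rule assms)

lemma square_integrable_add:
  assumes "square_integrable M X" "square_integrable M Y"
  shows "square_integrable M (\<lambda>\<omega>. X \<omega> + Y \<omega>)"
proof (rule square_integrable_bound)
  show "integrable M (\<lambda>\<omega>. 2 * (norm (X \<omega>))\<^sup>2 + 2 * (norm (Y \<omega>))\<^sup>2)"
    using assms by (simp add: square_integrable_def)
qed (use assms in \<open>auto simp: norm_add_square_le square_integrable_measurable\<close>)

lemma square_integrable_scaleR:
  assumes "square_integrable M X"
  shows "square_integrable M (\<lambda>\<omega>. c *\<^sub>R X \<omega>)"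
  using assms by (auto simp: square_integrable_def power_mult_distrib)

lemma square_integrable_diff:
  assumes "square_integrable M X" "square_integrable M Y"
  shows "square_integrable M (\<lambda>\<omega>. X \<omega> - Y \<omega>)"
  using square_integrable_add[OF assms(1) square_integrable_scaleR[OF assms(2), of "-1"]] by simp

lemma square_integrable_zero: "square_integrable M (\<lambda>\<omega>. 0)"
  by (simp add: square_integrable_def)

lemma square_integrable_sum:
  assumes "\<And>k. k \<in> K \<Longrightarrow> square_integrable M (X k)"
  shows "square_integrable M (\<lambda>\<omega>. \<Sum>k\<in>K. X k \<omega>)"
  using assms
  by (induction K rule: infinite_finite_induct) (auto intro: square_integrable_add square_integrable_zero)

lemma square_integrable_average:
  assumes "\<And>i. i \<in> {1..N} \<Longrightarrow> square_integrable M (X i)"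
  shows "square_integrable M (\<lambda>\<omega>. average N (\<lambda>i. X i \<omega>))"
  unfolding average_def using assms by (intro square_integrable_scaleR square_integrable_sum)

lemma (in finite_measure) square_integrable_const: "square_integrable M (\<lambda>\<omega>. c)"
  by (simp add: square_integrable_def)

lemma (in finite_measure) square_integrable_lipschitz:
  fixes h :: "'b::euclidean_space \<Rightarrow> 'c::euclidean_space"
  assumes lip: "L-lipschitz_on UNIV h" and X: "square_integrable M X"
  shows "square_integrable M (\<lambda>\<omega>. h (X \<omega>))"
proof (rule square_integrable_bound)
  have "h \<in> borel_measurable borel"
    using lip by (intro borel_measurable_continuous_onI lipschitz_on_continuous_on)
  then show "(\<lambda>\<omega>. h (X \<omega>)) \<in> borel_measurable M"
    using X by (auto intro: measurable_compose square_integrable_measurable)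
  show "integrable M (\<lambda>\<omega>. 2 * (L\<^sup>2 * (norm (X \<omega>))\<^sup>2) + 2 * (norm (h 0))\<^sup>2)"
    using X by (simp add: square_integrable_def)
  show "(norm (h (X \<omega>)))\<^sup>2 \<le> 2 * (L\<^sup>2 * (norm (X \<omega>))\<^sup>2) + 2 * (norm (h 0))\<^sup>2" for \<omega>
  proof -
    have "norm (h (X \<omega>) - h 0) \<le> L * norm (X \<omega>)"
      using lipschitz_onD[OF lip, of "X \<omega>" 0] by (simp add: dist_norm)
    then have "(norm (h (X \<omega>) - h 0))\<^sup>2 \<le> (L * norm (X \<omega>))\<^sup>2"
      by (intro power_mono) auto
    then show ?thesis
      using norm_add_square_le[of "h (X \<omega>) - h 0" "h 0"] by (simp add: power_mult_distrib)
  qed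
qed

lemma integrable_inner_square_integrable:
  assumes X: "square_integrable M X" and Y: "square_integrable M Y"
  shows "integrable M (\<lambda>\<omega>. X \<omega> \<bullet> Y \<omega>)"
proof (rule Bochner_Integration.integrable_bound)
  show "integrable M (\<lambda>\<omega>. (norm (X \<omega>))\<^sup>2 + (norm (Y \<omega>))\<^sup>2)"
    using X Y by (simp add: square_integrable_def)
  show "(\<lambda>\<omega>. X \<omega> \<bullet> Y \<omega>) \<in> borel_measurable M"
    using X Y by (auto simp: square_integrable_def)
  have "\<bar>x \<bullet> y\<bar> \<le> (norm x)\<^sup>2 + (norm y)\<^sup>2" for x y :: 'b
  proof -
    have "\<bar>x \<bullet> y\<bar> \<le> norm x * norm y" by (rule Cauchy_Schwarz_ineq2)
    moreover have "2 * (norm x * norm y) \<le> (norm x)\<^sup>2 + (norm y)\<^sup>2"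
      using sum_squares_bound[of "norm x" "norm y"] by simp
    moreover have "0 \<le> norm x * norm y" by simp
    ultimately show ?thesis by linarith
  qed
  then show "AE \<omega> in M. norm (X \<omega> \<bullet> Y \<omega>) \<le> norm ((norm (X \<omega>))\<^sup>2 + (norm (Y \<omega>))\<^sup>2)"
    by (auto intro: order_trans[OF _ abs_ge_self])
qed

text \<open>The theorem of Pythagoras in \<open>L\<^sup>2\<close>.\<close>
lemma integral_norm_sum_square_orthogonal:
  assumes "finite K" and sq: "\<And>k. k \<in> K \<Longrightarrow> square_integrable M (X k)"
    and orth: "\<And>k l. k \<in> K \<Longrightarrow> l \<in> K \<Longrightarrow> k \<noteq> l \<Longrightarrow> (\<integral>\<omega>. X k \<omega> \<bullet> X l \<omega> \<partial>M) = 0"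
  shows "(\<integral>\<omega>. (norm (\<Sum>k\<in>K. X k \<omega>))\<^sup>2 \<partial>M) = (\<Sum>k\<in>K. \<integral>\<omega>. (norm (X k \<omega>))\<^sup>2 \<partial>M)"
proof -
  have "(\<integral>\<omega>. (norm (\<Sum>k\<in>K. X k \<omega>))\<^sup>2 \<partial>M) = (\<integral>\<omega>. (\<Sum>k\<in>K. \<Sum>l\<in>K. X l \<omega> \<bullet> X k \<omega>) \<partial>M)"
    by (simp add: power2_norm_eq_inner inner_sum_left inner_sum_right)
  also have "\<dots> = (\<Sum>k\<in>K. \<Sum>l\<in>K. \<integral>\<omega>. X l \<omega> \<bullet> X k \<omega> \<partial>M)"
    using sq
    by (simp add: Bochner_Integration.integral_sum integrable_inner_square_integrable)
  also have "\<dots> = (\<Sum>k\<in>K. \<Sum>l\<in>K. if l = k then \<integral>\<omega>. X k \<omega> \<bullet> X k \<omega> \<partial>M else 0)"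
    by (intro sum.cong refl) (auto simp: orth)
  also have "\<dots> = (\<Sum>k\<in>K. \<integral>\<omega>. (norm (X k \<omega>))\<^sup>2 \<partial>M)"
    using \<open>finite K\<close> by (simp add: power2_norm_eq_inner)
  finally show ?thesis .
qed

section \<open>Momentum iterations with periodic averaging\<close>

text \<open>
  Used with \<open>q = 1 - \<beta>\<close>, so that the weights stay bounded as \<open>\<beta>\<close> tends to \<open>0\<close> and vanishing
  momentum is covered as well.
\<close>
lemma weighted_young:
  fixes a b q :: real
  assumes "0 < q"
  shows "a * b \<le> q / 2 * a\<^sup>2 + b\<^sup>2 / (2 * q)"
proof -
  have "2 * q * (a * b) \<le> q\<^sup>2 * a\<^sup>2 + b\<^sup>2"
    using sum_squares_bound[of "q * a" b] by (simp add: power_mult_distrib mult.assoc)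
  then have "a * b \<le> (q\<^sup>2 * a\<^sup>2 + b\<^sup>2) / (2 * q)"
    using assms by (simp add: pos_le_divide_eq mult.commute)
  also have "\<dots> = q / 2 * a\<^sup>2 + b\<^sup>2 / (2 * q)"
    using assms by (simp add: add_divide_distrib power2_eq_square)
  finally show ?thesis .
qed

text \<open>
  One realisation of the method with arbitrary search directions \<open>g\<close>. Everything that holds for every
  sample path, irrespective of where the directions come from, is proved here.
\<close>
locale momentum_run =
  fixes N I :: nat and \<beta> \<gamma> :: real and x0 :: "'a::euclidean_space"
    and u x g :: "nat \<Rightarrow> nat \<Rightarrow> 'a"
  assumes N: "1 \<le> N" and \<beta>: "0 \<le> \<beta>" "\<beta> < 1"
    and u_0: "u 0 = (\<lambda>i. 0)" and x_0: "x 0 = (\<lambda>i. x0)"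
    and u_Suc: "u (Suc t) =
      (if I dvd Suc t then (\<lambda>i. average N (\<lambda>j. \<beta> *\<^sub>R u t j + g t j))
       else (\<lambda>i. \<beta> *\<^sub>R u t i + g t i))"
    and x_Suc: "x (Suc t) =
      (if I dvd Suc t then (\<lambda>i. average N (\<lambda>j. x t j - \<gamma> *\<^sub>R (\<beta> *\<^sub>R u t j + g t j)))
       else (\<lambda>i. x t i - \<gamma> *\<^sub>R (\<beta> *\<^sub>R u t i + g t i)))"
begin

abbreviation "ubar t \<equiv> average N (u t)"
abbreviation "xbar t \<equiv> average N (x t)"
abbreviation "gbar t \<equiv> average N (g t)"

text \<open>
  The usual auxiliary sequence \<open>xbar t / (1 - \<beta>) - \<beta> / (1 - \<beta>) xbar (t - 1)\<close> of momentum methods,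
  written through the momentum so that \<open>t = 0\<close> is no exception.
\<close>
definition aux_iterate :: "nat \<Rightarrow> 'a" where
  "aux_iterate t = xbar t - (\<beta> * \<gamma> / (1 - \<beta>)) *\<^sub>R ubar t"

lemma ubar_Suc: "ubar (Suc t) = \<beta> *\<^sub>R ubar t + gbar t"
proof -
  have "ubar (Suc t) = average N (\<lambda>i. \<beta> *\<^sub>R u t i + g t i)"
    using N by (cases "I dvd Suc t") (simp_all add: u_Suc average_const)
  then show ?thesis
    by (simp add: average_add average_scaleR)
qed

lemma xbar_Suc: "xbar (Suc t) = xbar t - \<gamma> *\<^sub>R ubar (Suc t)"
proof -
  have "xbar (Suc t) = average N (\<lambda>i. x t i - \<gamma> *\<^sub>R (\<beta> *\<^sub>R u t i + g t i))"
    using N by (cases "I dvd Suc t") (simp_all add: x_Suc average_const)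
  then show ?thesis
    by (simp add: average_diff average_scaleR average_add ubar_Suc)
qed

lemma aux_iterate_0: "aux_iterate 0 = x0"
  using N by (simp add: aux_iterate_def u_0 x_0 average_const)

lemma aux_iterate_Suc: "aux_iterate (Suc t) = aux_iterate t - (\<gamma> / (1 - \<beta>)) *\<^sub>R gbar t"
proof -
  have *: "\<gamma> + \<beta> * \<gamma> / (1 - \<beta>) = \<gamma> / (1 - \<beta>)"
    using \<beta> by (simp add: field_simps)
  have "aux_iterate (Suc t) = xbar t - (\<gamma> + \<beta> * \<gamma> / (1 - \<beta>)) *\<^sub>R ubar (Suc t)"
    by (simp add: aux_iterate_def xbar_Suc scaleR_add_left)
  then show ?thesis
    unfolding * by (simp add: aux_iterate_def ubar_Suc scaleR_add_right mult.commute)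
qed

text \<open>
  Convexity of the squared norm for the combination of \<open>a\<close> and \<open>b / (1 - \<beta>)\<close> with weights \<open>\<beta>\<close> and
  \<open>1 - \<beta>\<close>.
\<close>
lemma norm_momentum_step_square_le:
  fixes a b :: "'b::real_inner"
  shows "(norm (\<beta> *\<^sub>R a + b))\<^sup>2 \<le> \<beta> * (norm a)\<^sup>2 + (norm b)\<^sup>2 / (1 - \<beta>)"
proof -
  define r where "r = (norm b)\<^sup>2 / (1 - \<beta>)"
  have b: "(norm b)\<^sup>2 = (1 - \<beta>) * r"
    using \<beta> by (simp add: r_def)
  have "norm a * norm b \<le> (1 - \<beta>) / 2 * (norm a)\<^sup>2 + (norm b)\<^sup>2 / (2 * (1 - \<beta>))"
    using \<beta> by (intro weighted_young) simp
  also have "(norm b)\<^sup>2 / (2 * (1 - \<beta>)) = r / 2"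
    by (simp add: r_def)
  finally have "2 * \<beta> * (norm a * norm b) \<le> 2 * \<beta> * ((1 - \<beta>) / 2 * (norm a)\<^sup>2 + r / 2)"
    using \<beta> by (intro mult_left_mono) auto
  moreover have "norm (\<beta> *\<^sub>R a + b) \<le> \<beta> * norm a + norm b"
    using norm_triangle_ineq[of "\<beta> *\<^sub>R a" b] \<beta> by simp
  then have "(norm (\<beta> *\<^sub>R a + b))\<^sup>2 \<le> (\<beta> * norm a + norm b)\<^sup>2"
    by (intro power_mono) auto
  moreover have "(\<beta> * norm a + norm b)\<^sup>2 = \<beta>\<^sup>2 * (norm a)\<^sup>2 + 2 * \<beta> * (norm a * norm b) + (1 - \<beta>) * r"
    unfolding b[symmetric] by (simp add: power2_sum power_mult_distrib)
  ultimately have "(norm (\<beta> *\<^sub>R a + b))\<^sup>2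
      \<le> \<beta>\<^sup>2 * (norm a)\<^sup>2 + 2 * \<beta> * ((1 - \<beta>) / 2 * (norm a)\<^sup>2 + r / 2) + (1 - \<beta>) * r"
    by linarith
  also have "\<dots> = \<beta> * (norm a)\<^sup>2 + r"
    by (simp add: power2_eq_square field_simps)
  finally show ?thesis by (simp add: r_def)
qed

text \<open>
  One momentum step contracts the energy by \<open>\<beta>\<close> and adds \<open>1 / (1 - \<beta>)\<close> times that of \<open>gbar\<close>;
  summing this recursion avoids the explicit double sum over the history.
\<close>
lemma sum_norm_ubar_square_le:
  "(\<Sum>t<T. (norm (ubar t))\<^sup>2) \<le> (\<Sum>t<T. (norm (gbar t))\<^sup>2) / (1 - \<beta>)\<^sup>2"
proof -
  have "(1 - \<beta>) * (\<Sum>t<T. (norm (ubar t))\<^sup>2) + (norm (ubar T))\<^sup>2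
      \<le> (\<Sum>t<T. (norm (gbar t))\<^sup>2) / (1 - \<beta>)"
  proof (induction T)
    case 0
    then show ?case using N by (simp add: u_0 average_const)
  next
    case (Suc T)
    have "(norm (ubar (Suc T)))\<^sup>2 \<le> \<beta> * (norm (ubar T))\<^sup>2 + (norm (gbar T))\<^sup>2 / (1 - \<beta>)"
      unfolding ubar_Suc by (rule norm_momentum_step_square_le)
    with Suc show ?case
      by (simp add: algebra_simps add_divide_distrib)
  qed
  then have "(1 - \<beta>) * (\<Sum>t<T. (norm (ubar t))\<^sup>2) \<le> (\<Sum>t<T. (norm (gbar t))\<^sup>2) / (1 - \<beta>)"
    by (smt (verit) zero_le_power2)
  then show ?thesis
    using \<beta> by (simp add: pos_le_divide_eq power2_eq_square mult_ac)
qed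

text \<open>
  Summing on each sample path makes the objective values telescope before any expectation is
  taken; once the left-hand side is bounded below by the minimum, only gradients remain to be
  integrated.
\<close>
lemma sum_descent:
  fixes f :: "'a \<Rightarrow> real"
  assumes grad: "\<And>y. GDERIV f y :> f' y" and lip: "L-lipschitz_on UNIV f'"
  shows "f (aux_iterate T) \<le> f x0 + (\<Sum>t<T. L * \<gamma>\<^sup>2 / (2 * (1 - \<beta>)\<^sup>2) * (norm (gbar t))\<^sup>2
    - \<gamma> / (1 - \<beta>) * (f' (aux_iterate t) \<bullet> gbar t))"
proof (induction T)
  case 0
  then show ?case by (simp add: aux_iterate_0)
next
  case (Suc T)
  have "f (aux_iterate (Suc T)) \<le> f (aux_iterate T) - \<gamma> / (1 - \<beta>) * (f' (aux_iterate T) \<bullet> gbar T)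
      + L / 2 * (norm ((\<gamma> / (1 - \<beta>)) *\<^sub>R gbar T))\<^sup>2"
    using descent_lemma[OF grad lip, of "aux_iterate T" "- ((\<gamma> / (1 - \<beta>)) *\<^sub>R gbar T)"]
    by (simp add: aux_iterate_Suc)
  also have "L / 2 * (norm ((\<gamma> / (1 - \<beta>)) *\<^sub>R gbar T))\<^sup>2 = L * \<gamma>\<^sup>2 / (2 * (1 - \<beta>)\<^sup>2) * (norm (gbar T))\<^sup>2"
    by (simp add: power_mult_distrib power_divide)
  finally show ?case
    using Suc by simp
qed

text \<open>
  The inner product is evaluated at the mean iterate by polarization, and the error of moving there
  from \<open>z\<close> is bounded through the Lipschitz constant and \<open>weighted_young\<close>. In the application \<open>y\<close> is the
  mean of the local gradients.
\<close>
lemma gradient_aux_inner_le: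
  assumes lip: "L-lipschitz_on UNIV f'" and \<gamma>: "0 < \<gamma>"
  shows "- (f' (aux_iterate t) \<bullet> y) \<le> - (norm (f' (xbar t)))\<^sup>2 / 2 - (norm y)\<^sup>2 / 2
    + (norm (f' (xbar t) - y))\<^sup>2 / 2
    + L * \<beta> * \<gamma> / 2 * (norm (ubar t))\<^sup>2 + L * \<beta> * \<gamma> / (2 * (1 - \<beta>)\<^sup>2) * (norm y)\<^sup>2"
proof -
  define p where "p = f' (xbar t) - f' (aux_iterate t)"
  have L: "0 \<le> L" using lip by (rule lipschitz_on_nonneg)
  define c where "c = L * \<beta> * \<gamma> / (1 - \<beta>)"
  have c: "0 \<le> c" using L \<beta> \<gamma> by (simp add: c_def)
  have "norm p \<le> L * dist (xbar t) (aux_iterate t)"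
    using lipschitz_onD[OF lip, of "xbar t" "aux_iterate t"] by (simp add: p_def dist_norm)
  also have "\<dots> = c * norm (ubar t)"
    using \<beta> \<gamma> by (simp add: aux_iterate_def dist_norm c_def)
  finally have p: "norm p \<le> c * norm (ubar t)" .
  have "p \<bullet> y \<le> norm p * norm y" by (rule norm_cauchy_schwarz)
  also have "\<dots> \<le> c * (norm (ubar t) * norm y)"
    using mult_right_mono[OF p, of "norm y"] by (simp add: mult.assoc)
  also have "\<dots> \<le> c * ((1 - \<beta>) / 2 * (norm (ubar t))\<^sup>2 + (norm y)\<^sup>2 / (2 * (1 - \<beta>)))"
    using \<beta> by (intro mult_left_mono weighted_young c) simp
  also have "\<dots> = L * \<beta> * \<gamma> / 2 * (norm (ubar t))\<^sup>2 + L * \<beta> * \<gamma> / (2 * (1 - \<beta>)\<^sup>2) * (norm y)\<^sup>2"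
  proof -
    have "m / q * (q / 2 * A + B / (2 * q)) = m / 2 * A + m / (2 * q\<^sup>2) * B" if "q \<noteq> 0" for m q A B :: real
      using that by (simp add: power2_eq_square distrib_left)
    from this[of "1 - \<beta>"] show ?thesis using \<beta> by (simp add: c_def)
  qed
  finally have "p \<bullet> y \<le> L * \<beta> * \<gamma> / 2 * (norm (ubar t))\<^sup>2 + L * \<beta> * \<gamma> / (2 * (1 - \<beta>)\<^sup>2) * (norm y)\<^sup>2" .
  moreover have "- (f' (aux_iterate t) \<bullet> y) = p \<bullet> y - f' (xbar t) \<bullet> y"
    by (simp add: p_def inner_diff_left)
  moreover have "f' (xbar t) \<bullet> y = (norm (f' (xbar t)))\<^sup>2 / 2 + (norm y)\<^sup>2 / 2 - (norm (f' (xbar t) - y))\<^sup>2 / 2"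
    unfolding power2_norm_eq_inner
    by (simp add: inner_commute[of y "f' (xbar t)"] inner_diff_left inner_diff_right field_simps)
  ultimately show ?thesis by linarith
qed

text \<open>The total weight with which a search direction has entered an iterate \<open>n\<close> steps later.\<close>
definition memory_weight :: "nat \<Rightarrow> real" where
  "memory_weight n = (\<Sum>l<n. \<beta> ^ l)"

lemma memory_weight_square_le: "(memory_weight n)\<^sup>2 \<le> 1 / (1 - \<beta>)\<^sup>2"
proof -
  have "memory_weight n * (1 - \<beta>) = 1 - \<beta> ^ n"
    using \<beta> by (simp add: memory_weight_def sum_gp_strict)
  then have "memory_weight n \<le> 1 / (1 - \<beta>)"
    using \<beta> by (simp add: pos_le_divide_eq)
  moreover have "0 \<le> memory_weight n"
    using \<beta> by (simp add: memory_weight_def sum_nonneg)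
  ultimately have "(memory_weight n)\<^sup>2 \<le> (1 / (1 - \<beta>))\<^sup>2"
    by (rule power_mono)
  then show ?thesis by (simp add: power_divide)
qed

lemma synchronized:
  assumes "I dvd s"
  shows "u s i = ubar s" "x s i = xbar s"
  using N assms
  by (cases s; simp add: u_0 x_0 u_Suc x_Suc average_const)+

text \<open>
  A synchronization erases all deviations, of momenta and of iterates, so only the search directions
  since the last one contribute.
\<close>
lemma deviation_from_mean:
  assumes "I dvd s" "n < I"
  shows "u (s + n) i - ubar (s + n) = (\<Sum>k<n. \<beta> ^ (n - Suc k) *\<^sub>R (g (s + k) i - gbar (s + k)))" (is "?U n")
    and "x (s + n) i - xbar (s + n) =
      - \<gamma> *\<^sub>R (\<Sum>k<n. memory_weight (n - k) *\<^sub>R (g (s + k) i - gbar (s + k)))" (is "?X n")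
proof -
  let ?d = "\<lambda>k. g (s + k) i - gbar (s + k)"
  have "?U n \<and> ?X n"
    using assms(2)
  proof (induction n)
    case 0
    then show ?case using synchronized[OF assms(1), of i] by simp
  next
    case (Suc n)
    then have U: "?U n" and X: "?X n" by simp_all
    \<comment> \<open>no synchronization at \<open>s + n + 1\<close>, since \<open>n + 1 < I\<close>\<close>
    have nodvd: "\<not> I dvd Suc (s + n)"
    proof
      assume "I dvd Suc (s + n)"
      with assms(1) have "I dvd Suc n"
        by (metis add_Suc_right dvd_add_right_iff)
      with Suc.prems show False by (auto dest: dvd_imp_le)
    qed
    have u_step: "u (Suc (s + n)) i = \<beta> *\<^sub>R u (s + n) i + g (s + n) i"
      using nodvd by (simp add: u_Suc)
    then have x_step: "x (Suc (s + n)) i = x (s + n) i - \<gamma> *\<^sub>R u (Suc (s + n)) i"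
      using nodvd by (simp add: x_Suc)
    have "u (s + Suc n) i - ubar (s + Suc n) = \<beta> *\<^sub>R (u (s + n) i - ubar (s + n)) + ?d n"
      unfolding add_Suc_right u_step ubar_Suc by (simp add: algebra_simps)
    also have "\<dots> = (\<Sum>k<n. (\<beta> * \<beta> ^ (n - Suc k)) *\<^sub>R ?d k) + ?d n"
      by (simp add: U scaleR_sum_right)
    also have "(\<Sum>k<n. (\<beta> * \<beta> ^ (n - Suc k)) *\<^sub>R ?d k) = (\<Sum>k<n. \<beta> ^ (n - k) *\<^sub>R ?d k)"
      by (intro sum.cong refl) (simp add: power_Suc[symmetric] Suc_diff_Suc del: power_Suc)
    finally have U': "?U (Suc n)" by simp
    have "x (s + Suc n) i - xbar (s + Suc n)
        = (x (s + n) i - xbar (s + n)) - \<gamma> *\<^sub>R (u (s + Suc n) i - ubar (s + Suc n))"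
      by (simp add: x_step xbar_Suc scaleR_diff_right)
    also have "\<dots> = - \<gamma> *\<^sub>R ((\<Sum>k<Suc n. memory_weight (n - k) *\<^sub>R ?d k) + (\<Sum>k<Suc n. \<beta> ^ (n - k) *\<^sub>R ?d k))"
      unfolding U' X by (simp add: memory_weight_def[of 0] algebra_simps)
    also have "(\<Sum>k<Suc n. memory_weight (n - k) *\<^sub>R ?d k) + (\<Sum>k<Suc n. \<beta> ^ (n - k) *\<^sub>R ?d k)
        = (\<Sum>k<Suc n. memory_weight (Suc n - k) *\<^sub>R ?d k)"
      unfolding sum.distrib[symmetric]
      by (intro sum.cong refl) (simp add: memory_weight_def Suc_diff_le scaleR_add_left)
    finally show ?case using U' by blast
  qed
  then show "?U n" "?X n" by simp_all
qed

text \<open>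
  Here \<open>h\<close> stands for the exact local gradients, but any sequence will do. The two parts of \<open>g\<close> are
  kept apart because they scale differently: the squared sum of the errors \<open>g - h\<close> is left intact so
  that their orthogonality can be exploited in expectation, while Cauchy-Schwarz, at the price of
  a factor \<open>n\<close>, is applied only to the spread of \<open>h\<close>.
\<close>
lemma average_square_deviation_split:
  assumes "I dvd s" "n < I"
  shows "average N (\<lambda>i. (norm (x (s + n) i - xbar (s + n)))\<^sup>2) \<le>
    2 * \<gamma>\<^sup>2 * average N (\<lambda>i. (norm (\<Sum>k<n. memory_weight (n - k) *\<^sub>R (g (s + k) i - h (s + k) i)))\<^sup>2)
    + 2 * \<gamma>\<^sup>2 * real n / (1 - \<beta>)\<^sup>2 *
      (\<Sum>k<n. average N (\<lambda>i. (norm (h (s + k) i - average N (h (s + k))))\<^sup>2))"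
proof -
  define a where "a i = (\<Sum>k<n. memory_weight (n - k) *\<^sub>R (g (s + k) i - h (s + k) i))" for i
  define b where "b i = (\<Sum>k<n. memory_weight (n - k) *\<^sub>R (h (s + k) i - average N (h (s + k))))" for i
  have avg_a: "average N a = (\<Sum>k<n. memory_weight (n - k) *\<^sub>R (gbar (s + k) - average N (h (s + k))))"
    unfolding a_def by (simp add: average_sum average_scaleR average_diff)
  have "(\<Sum>k<n. memory_weight (n - k) *\<^sub>R (g (s + k) i - gbar (s + k))) = (a i - average N a) + b i" for i
    unfolding avg_a a_def b_def sum_subtractf[symmetric] sum.distrib[symmetric]
    by (intro sum.cong refl) (simp add: algebra_simps)
  then have dev: "x (s + n) i - xbar (s + n) = - \<gamma> *\<^sub>R ((a i - average N a) + b i)" for i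
    by (simp add: deviation_from_mean(2)[OF assms])
  have b: "(norm (b i))\<^sup>2 \<le> real n / (1 - \<beta>)\<^sup>2 * (\<Sum>k<n. (norm (h (s + k) i - average N (h (s + k))))\<^sup>2)" for i
  proof -
    have "(norm (b i))\<^sup>2 \<le> real n * (\<Sum>k<n. (memory_weight (n - k))\<^sup>2 * (norm (h (s + k) i - average N (h (s + k))))\<^sup>2)"
      using norm_sum_square_le[of "{..<n}" "\<lambda>k. memory_weight (n - k) *\<^sub>R (h (s + k) i - average N (h (s + k)))"]
      by (simp add: b_def power_mult_distrib)
    also have "\<dots> \<le> real n * (\<Sum>k<n. 1 / (1 - \<beta>)\<^sup>2 * (norm (h (s + k) i - average N (h (s + k))))\<^sup>2)"
      by (intro mult_left_mono sum_mono mult_right_mono memory_weight_square_le) auto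
    finally show ?thesis by (simp add: sum_divide_distrib[symmetric])
  qed
  have "average N (\<lambda>i. (norm (x (s + n) i - xbar (s + n)))\<^sup>2)
      = \<gamma>\<^sup>2 * average N (\<lambda>i. (norm ((a i - average N a) + b i))\<^sup>2)"
    by (simp add: dev power_mult_distrib average_mult)
  also have "\<dots> \<le> \<gamma>\<^sup>2 * average N (\<lambda>i. 2 * (norm (a i - average N a))\<^sup>2 + 2 * (norm (b i))\<^sup>2)"
    by (intro mult_left_mono average_mono norm_add_square_le) simp
  also have "\<dots> = 2 * \<gamma>\<^sup>2 * average N (\<lambda>i. (norm (a i - average N a))\<^sup>2) + 2 * \<gamma>\<^sup>2 * average N (\<lambda>i. (norm (b i))\<^sup>2)"
    by (simp add: average_add average_mult algebra_simps)
  also have "\<dots> \<le> 2 * \<gamma>\<^sup>2 * average N (\<lambda>i. (norm (a i))\<^sup>2)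
      + 2 * \<gamma>\<^sup>2 * average N (\<lambda>i. real n / (1 - \<beta>)\<^sup>2 * (\<Sum>k<n. (norm (h (s + k) i - average N (h (s + k))))\<^sup>2))"
  proof -
    have "average N (\<lambda>i. (norm (a i - average N a))\<^sup>2) \<le> average N (\<lambda>i. (norm (a i))\<^sup>2)"
      using average_square_deviation_le[OF N, of a 0] by simp
    moreover have "average N (\<lambda>i. (norm (b i))\<^sup>2) \<le> average N (\<lambda>i. real n / (1 - \<beta>)\<^sup>2 *
        (\<Sum>k<n. (norm (h (s + k) i - average N (h (s + k))))\<^sup>2))"
      by (intro average_mono b)
    ultimately show ?thesis
      by (intro add_mono mult_left_mono) simp_all
  qed
  finally show ?thesis
    unfolding average_mult average_sum a_def by (simp add: mult.assoc)
qed

end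

section \<open>The stochastic process of all workers\<close>

locale pr_sgdm = prob_space M
  for M :: "'w measure" +
  fixes N I :: nat
    and D :: "nat \<Rightarrow> 'd measure"
    and F :: "nat \<Rightarrow> 'a::euclidean_space \<Rightarrow> 'd \<Rightarrow> real"
    and \<xi> :: "nat \<Rightarrow> nat \<Rightarrow> 'w \<Rightarrow> 'd"
    and x0 :: 'a
    and L \<sigma> \<kappa> \<beta> \<gamma> :: real
  assumes N: "1 \<le> N"
    and distributions: "i \<in> {1..N} \<Longrightarrow> prob_space (D i)"
    and F_integrable: "i \<in> {1..N} \<Longrightarrow> integrable (D i) (F i y)"
    and F_differentiable: "i \<in> {1..N} \<Longrightarrow> z \<in> space (D i) \<Longrightarrow> (\<lambda>y. F i y z) differentiable (at y)"
    and unbiased: "i \<in> {1..N} \<Longrightarrow>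
      has_bochner_integral (D i) (\<lambda>z. gradient (\<lambda>y. F i y z) y) (gradient (local_objective D F i) y)"
    and L: "0 < L"
    and smooth_differentiable: "i \<in> {1..N} \<Longrightarrow> local_objective D F i differentiable (at y)"
    and smooth_Lipschitz: "i \<in> {1..N} \<Longrightarrow> L-lipschitz_on UNIV (gradient (local_objective D F i))"
    and variance_integrable: "i \<in> {1..N} \<Longrightarrow> integrable (D i)
      (\<lambda>z. (norm (gradient (\<lambda>y. F i y z) y - gradient (local_objective D F i) y))\<^sup>2)"
    and variance_bound: "i \<in> {1..N} \<Longrightarrow>
      (\<integral>z. (norm (gradient (\<lambda>y. F i y z) y - gradient (local_objective D F i) y))\<^sup>2 \<partial>(D i)) \<le> \<sigma>\<^sup>2"
    and dissimilarity_bound: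
      "average N (\<lambda>i. (norm (gradient (local_objective D F i) y - gradient (global_objective N D F) y))\<^sup>2) \<le> \<kappa>\<^sup>2"
    and samples_distr: "i \<in> {1..N} \<Longrightarrow> distr M (D i) (\<xi> t i) = D i"
    and samples_indep: "indep_vars (\<lambda>(t, i). D i) (\<lambda>(t, i). \<xi> t i) (UNIV \<times> {1..N})"
    and \<beta>: "0 \<le> \<beta>" "\<beta> < 1" and \<gamma>: "0 < \<gamma>" and I: "1 \<le> I"
begin

abbreviation "fbar \<equiv> global_objective N D F"
abbreviation "fbar' \<equiv> gradient (global_objective N D F)"
abbreviation "f' i \<equiv> gradient (local_objective D F i)"

lemma GDERIV_average_gradient: "GDERIV fbar y :> average N (\<lambda>i. f' i y)"
  unfolding global_objective_def[abs_def]
  by (intro GDERIV_average GDERIV_gradient smooth_differentiable)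

lemma global_gradient_eq: "fbar' y = average N (\<lambda>i. f' i y)"
  by (rule gradient_eqI) (rule GDERIV_average_gradient)

lemma GDERIV_global: "GDERIV fbar y :> fbar' y"
  using GDERIV_average_gradient by (simp add: global_gradient_eq)

lemma global_Lipschitz: "L-lipschitz_on UNIV fbar'"
  unfolding global_gradient_eq[abs_def] using N L smooth_Lipschitz by (intro lipschitz_on_average) auto

definition G :: "nat \<Rightarrow> 'a \<Rightarrow> 'd \<Rightarrow> 'a" where
  "G i y z = gradient (\<lambda>y. F i y z) y"

definition u :: "nat \<Rightarrow> nat \<Rightarrow> 'w \<Rightarrow> 'a" where
  "u t i \<omega> = fst (sgdm_state N F \<beta> \<gamma> I x0 (\<lambda>t i. \<xi> t i \<omega>) t) i"

definition x :: "nat \<Rightarrow> nat \<Rightarrow> 'w \<Rightarrow> 'a" where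
  "x t i \<omega> = snd (sgdm_state N F \<beta> \<gamma> I x0 (\<lambda>t i. \<xi> t i \<omega>) t) i"

definition g :: "nat \<Rightarrow> nat \<Rightarrow> 'w \<Rightarrow> 'a" where
  "g t i \<omega> = G i (x t i \<omega>) (\<xi> t i \<omega>)"

definition h :: "nat \<Rightarrow> nat \<Rightarrow> 'w \<Rightarrow> 'a" where
  "h t i \<omega> = f' i (x t i \<omega>)"

definition noise :: "nat \<Rightarrow> nat \<Rightarrow> 'w \<Rightarrow> 'a" where
  "noise t i \<omega> = g t i \<omega> - h t i \<omega>"

sublocale sample_path: momentum_run N I \<beta> \<gamma> x0 "\<lambda>t i. u t i \<omega>" "\<lambda>t i. x t i \<omega>" "\<lambda>t i. g t i \<omega>" for \<omega>
  using N \<beta>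
  by unfold_locales
    (simp_all add: fun_eq_iff u_def x_def g_def G_def split_def Let_def)

lemma u_Suc: "u (Suc t) i \<omega> =
    (if I dvd Suc t then average N (\<lambda>j. \<beta> *\<^sub>R u t j \<omega> + g t j \<omega>) else \<beta> *\<^sub>R u t i \<omega> + g t i \<omega>)"
  using fun_cong[OF sample_path.u_Suc[of t \<omega>], of i] by simp

lemma x_Suc: "x (Suc t) i \<omega> =
    (if I dvd Suc t then average N (\<lambda>j. x t j \<omega> - \<gamma> *\<^sub>R (\<beta> *\<^sub>R u t j \<omega> + g t j \<omega>))
     else x t i \<omega> - \<gamma> *\<^sub>R (\<beta> *\<^sub>R u t i \<omega> + g t i \<omega>))"
  using fun_cong[OF sample_path.x_Suc[of t \<omega>], of i] by simp

lemma u_0: "u 0 i \<omega> = 0" and x_0: "x 0 i \<omega> = x0"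
  by (simp_all add: u_def x_def)

lemma measurable_stochastic_gradient:
  assumes "i \<in> {1..N}"
  shows "(\<lambda>(y, z). G i y z) \<in> borel_measurable (borel \<Otimes>\<^sub>M D i)"
  unfolding G_def
  using F_integrable[OF assms] F_differentiable[OF assms]
  by (intro borel_measurable_gradient) auto

lemma borel_measurable_local_gradient:
  assumes "i \<in> {1..N}"
  shows "f' i \<in> borel_measurable borel"
  using smooth_Lipschitz[OF assms]
  by (intro borel_measurable_continuous_onI lipschitz_on_continuous_on)

lemma borel_measurable_global_gradient: "fbar' \<in> borel_measurable borel"
  using global_Lipschitz by (intro borel_measurable_continuous_onI lipschitz_on_continuous_on)

lemma borel_measurable_average [measurable (raw)]:
  assumes "\<And>i. i \<in> {1..N} \<Longrightarrow> (v i :: 'b \<Rightarrow> 'c::euclidean_space) \<in> borel_measurable H"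
  shows "(\<lambda>\<omega>. average N (\<lambda>i. v i \<omega>)) \<in> borel_measurable H"
  unfolding average_def using assms by measurable

text \<open>
  Measurability is stated relative to an arbitrary \<open>\<sigma>\<close>-algebra \<open>H\<close> for which the samples drawn before
  time \<open>t\<close> are measurable. This serves both for the whole probability space and for the
  \<open>\<sigma>\<close>-algebra generated by all samples but one.
\<close>
lemma measurable_state:
  assumes "\<And>s j. s < t \<Longrightarrow> j \<in> {1..N} \<Longrightarrow> \<xi> s j \<in> H \<rightarrow>\<^sub>M D j" and "i \<in> {1..N}"
  shows "u t i \<in> borel_measurable H \<and> x t i \<in> borel_measurable H"
  using assms
proof (induction t arbitrary: i)
  case 0
  then show ?case by (simp add: u_0 x_0 cong: measurable_cong)
next
  case (Suc t)
  have [measurable]: "u t j \<in> borel_measurable H" "x t j \<in> borel_measurable H" if "j \<in> {1..N}" for j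
    using Suc.IH[OF _ that] Suc.prems(1) by auto
  have [measurable]: "g t j \<in> borel_measurable H" if "j \<in> {1..N}" for j
  proof -
    have "(\<lambda>\<omega>. (x t j \<omega>, \<xi> t j \<omega>)) \<in> H \<rightarrow>\<^sub>M borel \<Otimes>\<^sub>M D j"
      using that Suc.prems(1)[of t j] by (intro measurable_Pair) auto
    from measurable_compose[OF this measurable_stochastic_gradient[OF that]]
    show ?thesis by (simp add: g_def[abs_def])
  qed
  note [measurable] = Suc.prems(2)
  show ?case
    unfolding u_Suc[abs_def] x_Suc[abs_def]
    by (intro conjI; cases "I dvd Suc t"; simp; measurable)
qed

lemma measurable_local_gradients:
  assumes \<xi>: "\<And>s j. s < t \<Longrightarrow> j \<in> {1..N} \<Longrightarrow> \<xi> s j \<in> H \<rightarrow>\<^sub>M D j"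
    and \<xi>_i: "\<xi> t i \<in> H \<rightarrow>\<^sub>M D i" and i: "i \<in> {1..N}"
  shows "g t i \<in> borel_measurable H" "h t i \<in> borel_measurable H" "noise t i \<in> borel_measurable H"
proof -
  have x: "x t i \<in> borel_measurable H"
    using assms measurable_state[of t H i] by auto
  have "(\<lambda>\<omega>. (x t i \<omega>, \<xi> t i \<omega>)) \<in> H \<rightarrow>\<^sub>M borel \<Otimes>\<^sub>M D i"
    using x \<xi>_i by (intro measurable_Pair) auto
  from measurable_compose[OF this measurable_stochastic_gradient[OF i]]
  show g: "g t i \<in> borel_measurable H" by (simp add: g_def[abs_def])
  show h: "h t i \<in> borel_measurable H"
    unfolding h_def[abs_def] by (rule measurable_compose[OF x borel_measurable_local_gradient[OF i]])
  show "noise t i \<in> borel_measurable H"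
    unfolding noise_def[abs_def] using g h by measurable
qed

lemma measurable_sample:
  assumes "i \<in> {1..N}"
  shows "\<xi> t i \<in> M \<rightarrow>\<^sub>M D i"
  using samples_indep assms unfolding indep_vars_def by auto

text \<open>
  The \<open>\<sigma>\<close>-algebra generated by all samples except that of worker \<open>i\<close> at time \<open>t\<close>. Future samples may
  be included since they too are independent of the one left out; as opposed to a filtration in
  time, this also covers the other workers at time \<open>t\<close>.
\<close>
definition others :: "nat \<Rightarrow> nat \<Rightarrow> 'w measure" where
  "others t i = vimage_algebra (space M)
     (\<lambda>\<omega>. restrict (\<lambda>(s, j). \<xi> s j \<omega>) (UNIV \<times> {1..N} - {(t, i)}))
     (PiM (UNIV \<times> {1..N} - {(t, i)}) (\<lambda>(s, j). D j))"

lemma measurable_restrict_samples: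
  assumes "J \<subseteq> UNIV \<times> {1..N}"
  shows "(\<lambda>\<omega>. restrict (\<lambda>(s, j). \<xi> s j \<omega>) J) \<in> M \<rightarrow>\<^sub>M PiM J (\<lambda>(s, j). D j)"
  using assms by (intro measurable_restrict) (auto intro!: measurable_sample)

lemma measurable_sample_others:
  assumes "j \<in> {1..N}" "(s, j) \<noteq> (t, i)"
  shows "\<xi> s j \<in> others t i \<rightarrow>\<^sub>M D j"
proof -
  let ?J = "UNIV \<times> {1..N} - {(t, i)}"
  have "(\<lambda>\<omega>. restrict (\<lambda>(s, j). \<xi> s j \<omega>) ?J) \<in> others t i \<rightarrow>\<^sub>M PiM ?J (\<lambda>(s, j). D j)"
    unfolding others_def
    using measurable_space[OF measurable_restrict_samples[of ?J]]
    by (intro measurable_vimage_algebra1) auto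
  moreover have "(\<lambda>r. r (s, j)) \<in> PiM ?J (\<lambda>(s, j). D j) \<rightarrow>\<^sub>M (case (s, j) of (s, j) \<Rightarrow> D j)"
    using assms by (intro measurable_component_singleton) auto
  ultimately have "(\<lambda>\<omega>. restrict (\<lambda>(s, j). \<xi> s j \<omega>) ?J (s, j)) \<in> others t i \<rightarrow>\<^sub>M (case (s, j) of (s, j) \<Rightarrow> D j)"
    by (rule measurable_compose)
  then show ?thesis using assms by simp
qed

lemma measurable_others_id: "(\<lambda>\<omega>. \<omega>) \<in> M \<rightarrow>\<^sub>M others t i"
  unfolding others_def
  by (rule measurable_vimage_algebra2) (auto intro: measurable_restrict_samples)

text \<open>
  Independence as a product formula in which the other samples are represented by \<open>\<omega>\<close> itself, with
  the smaller \<open>\<sigma>\<close>-algebra. Functions of the other samples then need not be factored through these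
  samples before applying Fubini.
\<close>
lemma joint_distr_sample:
  assumes i: "i \<in> {1..N}"
  shows "distr M (others t i \<Otimes>\<^sub>M D i) (\<lambda>\<omega>. (\<omega>, \<xi> t i \<omega>)) = distr M (others t i) (\<lambda>\<omega>. \<omega>) \<Otimes>\<^sub>M D i"
proof -
  let ?J = "UNIV \<times> {1..N} - {(t, i)}"
  let ?R = "\<lambda>J \<omega>. restrict (\<lambda>(s, j). \<xi> s j \<omega>) J" and ?P = "\<lambda>J. PiM J (\<lambda>(s, j). D j)"
  have R: "(\<lambda>\<omega>. restrict (\<lambda>k. (case k of (s, j) \<Rightarrow> \<xi> s j) \<omega>) J) = ?R J" for J
    by (intro ext) (auto simp: restrict_def)
  have "indep_var (?P ?J) (?R ?J) (?P {(t, i)}) (?R {(t, i)})"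
    using indep_var_restrict[OF samples_indep, of ?J "{(t, i)}"] i unfolding R by auto
  moreover have "(\<lambda>r. r (t, i)) \<in> ?P {(t, i)} \<rightarrow>\<^sub>M (case (t, i) of (s, j) \<Rightarrow> D j)"
    by (intro measurable_component_singleton) auto
  note coordinate = this
  ultimately have indep: "indep_set (sets (others t i))
      (sigma_sets (space M) {?R {(t, i)} -` A \<inter> space M | A. A \<in> sets (?P {(t, i)})})"
    unfolding indep_var_eq others_def sets_vimage_algebra by blast
  have sample_event: "\<xi> t i -` B \<inter> space M \<in>
      sigma_sets (space M) {?R {(t, i)} -` A \<inter> space M | A. A \<in> sets (?P {(t, i)})}"
    if "B \<in> sets (D i)" for B
  proof (rule sigma_sets.Basic, rule CollectI, intro exI conjI)
    show "(\<lambda>r. r (t, i)) -` B \<inter> space (?P {(t, i)}) \<in> sets (?P {(t, i)})"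
      using coordinate that by (auto dest: measurable_sets)
    show "\<xi> t i -` B \<inter> space M = ?R {(t, i)} -` ((\<lambda>r. r (t, i)) -` B \<inter> space (?P {(t, i)})) \<inter> space M"
      using measurable_space[OF measurable_restrict_samples[of "{(t, i)}"]] i by auto
  qed
  have pair: "(\<lambda>\<omega>. (\<omega>, \<xi> t i \<omega>)) \<in> M \<rightarrow>\<^sub>M others t i \<Otimes>\<^sub>M D i"
    using measurable_others_id measurable_sample[OF i] by (rule measurable_Pair)
  interpret D: prob_space "D i" by (rule distributions) fact
  interpret P: prob_space "distr M (others t i) (\<lambda>\<omega>. \<omega>)"
    by (rule prob_space_distr) (rule measurable_others_id)
  have "distr M (others t i) (\<lambda>\<omega>. \<omega>) \<Otimes>\<^sub>M D i = distr M (others t i \<Otimes>\<^sub>M D i) (\<lambda>\<omega>. (\<omega>, \<xi> t i \<omega>))"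
  proof (rule pair_measure_eqI)
    show "sigma_finite_measure (distr M (others t i) (\<lambda>\<omega>. \<omega>))" "sigma_finite_measure (D i)" ..
    show "sets (distr M (others t i) (\<lambda>\<omega>. \<omega>) \<Otimes>\<^sub>M D i) =
        sets (distr M (others t i \<Otimes>\<^sub>M D i) (\<lambda>\<omega>. (\<omega>, \<xi> t i \<omega>)))"
      by (simp cong: sets_pair_measure_cong)
    fix A B assume A: "A \<in> sets (distr M (others t i) (\<lambda>\<omega>. \<omega>))" and B: "B \<in> sets (D i)"
    then have A': "A \<in> sets (others t i)" by simp
    then have "A \<subseteq> space M"
      using sets.sets_into_space[of A "others t i"] by (simp add: others_def)
    then have vimage: "(\<lambda>\<omega>. (\<omega>, \<xi> t i \<omega>)) -` (A \<times> B) \<inter> space M = A \<inter> (\<xi> t i -` B \<inter> space M)"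
        "(\<lambda>\<omega>. \<omega>) -` A \<inter> space M = A"
      by auto
    have "emeasure (distr M (others t i) (\<lambda>\<omega>. \<omega>)) A = ennreal (prob A)"
      using emeasure_distr[OF measurable_others_id A'] vimage by (simp add: emeasure_eq_measure)
    moreover have "emeasure (D i) B = ennreal (prob (\<xi> t i -` B \<inter> space M))"
      using emeasure_distr[OF measurable_sample[OF i, of t] B]
      by (simp add: samples_distr[OF i] emeasure_eq_measure)
    moreover have "emeasure (distr M (others t i \<Otimes>\<^sub>M D i) (\<lambda>\<omega>. (\<omega>, \<xi> t i \<omega>))) (A \<times> B)
        = ennreal (prob (A \<inter> (\<xi> t i -` B \<inter> space M)))"
      using emeasure_distr[OF pair, of "A \<times> B"] A' B vimage by (simp add: emeasure_eq_measure)
    ultimately show "emeasure (distr M (others t i) (\<lambda>\<omega>. \<omega>)) A * emeasure (D i) B =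
        emeasure (distr M (others t i \<Otimes>\<^sub>M D i) (\<lambda>\<omega>. (\<omega>, \<xi> t i \<omega>))) (A \<times> B)"
      using indep_setD[OF indep A' sample_event[OF B]] by (simp add: ennreal_mult)
  qed
  then show ?thesis by simp
qed

lemma measurable_x_others:
  assumes "i \<in> {1..N}"
  shows "x t i \<in> borel_measurable (others t j)"
  using assms measurable_state[of t "others t j" i] measurable_sample_others[of _ _ t j] by auto

lemma measurable_oracle_error:
  assumes i: "i \<in> {1..N}"
  shows "(\<lambda>p. G i (x t i (fst p)) (snd p) - f' i (x t i (fst p))) \<in> borel_measurable (others t i \<Otimes>\<^sub>M D i)"
proof -
  have x: "(\<lambda>p. x t i (fst p)) \<in> borel_measurable (others t i \<Otimes>\<^sub>M D i)"
    using measurable_compose[OF measurable_fst measurable_x_others[OF i]] .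
  then have "(\<lambda>p. (x t i (fst p), snd p)) \<in> others t i \<Otimes>\<^sub>M D i \<rightarrow>\<^sub>M borel \<Otimes>\<^sub>M D i"
    by (intro measurable_Pair) auto
  from measurable_compose[OF this measurable_stochastic_gradient[OF i]]
    measurable_compose[OF x borel_measurable_local_gradient[OF i]]
  show ?thesis by (simp add: borel_measurable_diff)
qed

text \<open>
  The current iterate depends only on the other samples, so integrating over the fresh sample first
  gives the variance bound at a fixed point.
\<close>
lemma noise_second_moment:
  assumes i: "i \<in> {1..N}"
  shows "square_integrable M (noise t i)" and "expectation (\<lambda>\<omega>. (norm (noise t i \<omega>))\<^sup>2) \<le> \<sigma>\<^sup>2"
proof -
  interpret D: prob_space "D i" by (rule distributions) fact
  interpret P: prob_space "distr M (others t i) (\<lambda>\<omega>. \<omega>)"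
    by (rule prob_space_distr) (rule measurable_others_id)
  have meas: "noise t i \<in> borel_measurable M"
    using measurable_local_gradients(3)[OF _ _ i] measurable_sample i by blast
  define \<phi> where "\<phi> p = ennreal ((norm (G i (x t i (fst p)) (snd p) - f' i (x t i (fst p))))\<^sup>2)" for p
  have \<phi>: "\<phi> \<in> borel_measurable (others t i \<Otimes>\<^sub>M D i)"
    unfolding \<phi>_def[abs_def] using measurable_oracle_error[OF i] by measurable
  have pair: "(\<lambda>\<omega>. (\<omega>, \<xi> t i \<omega>)) \<in> M \<rightarrow>\<^sub>M others t i \<Otimes>\<^sub>M D i"
    using measurable_others_id measurable_sample[OF i] by (rule measurable_Pair)
  have "(\<integral>\<^sup>+\<omega>. ennreal ((norm (noise t i \<omega>))\<^sup>2) \<partial>M) = (\<integral>\<^sup>+\<omega>. \<phi> (\<omega>, \<xi> t i \<omega>) \<partial>M)"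
    by (simp add: \<phi>_def noise_def g_def h_def)
  also have "\<dots> = integral\<^sup>N (distr M (others t i) (\<lambda>\<omega>. \<omega>) \<Otimes>\<^sub>M D i) \<phi>"
    unfolding joint_distr_sample[OF i, symmetric] using pair \<phi> by (subst nn_integral_distr) auto
  also have "\<dots> = (\<integral>\<^sup>+\<omega>. \<integral>\<^sup>+z. \<phi> (\<omega>, z) \<partial>D i \<partial>distr M (others t i) (\<lambda>\<omega>. \<omega>))"
    using \<phi> by (subst D.nn_integral_fst) (simp_all cong: measurable_cong_sets)
  also have "\<dots> \<le> (\<integral>\<^sup>+\<omega>. ennreal (\<sigma>\<^sup>2) \<partial>distr M (others t i) (\<lambda>\<omega>. \<omega>))"
  proof (rule nn_integral_mono)
    fix \<omega>
    show "(\<integral>\<^sup>+z. \<phi> (\<omega>, z) \<partial>D i) \<le> ennreal (\<sigma>\<^sup>2)"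
      using variance_integrable[OF i, of "x t i \<omega>"] variance_bound[OF i, of "x t i \<omega>"]
      by (simp add: \<phi>_def G_def nn_integral_eq_integral)
  qed
  also have "\<dots> = ennreal (\<sigma>\<^sup>2)"
    by (simp add: P.emeasure_space_1[simplified])
  finally have bound: "(\<integral>\<^sup>+\<omega>. ennreal ((norm (noise t i \<omega>))\<^sup>2) \<partial>M) \<le> ennreal (\<sigma>\<^sup>2)" .
  then show "square_integrable M (noise t i)"
    unfolding square_integrable_def using meas
    by (intro conjI integrableI_bounded) (auto simp: order_le_less_trans)
  show "expectation (\<lambda>\<omega>. (norm (noise t i \<omega>))\<^sup>2) \<le> \<sigma>\<^sup>2"
    using bound by (intro integral_real_bounded) simp_all
qed

text \<open>
  By Fubini the fresh sample can be integrated out first, with \<open>Y\<close> and the iterate fixed; the inner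
  integral vanishes because the stochastic gradient is unbiased.
\<close>
lemma noise_orthogonal:
  assumes i: "i \<in> {1..N}" and Y: "Y \<in> borel_measurable (others t i)" and sq: "square_integrable M Y"
  shows "expectation (\<lambda>\<omega>. Y \<omega> \<bullet> noise t i \<omega>) = 0"
proof -
  interpret D: prob_space "D i" by (rule distributions) fact
  interpret P: prob_space "distr M (others t i) (\<lambda>\<omega>. \<omega>)"
    by (rule prob_space_distr) (rule measurable_others_id)
  interpret PD: pair_sigma_finite "distr M (others t i) (\<lambda>\<omega>. \<omega>)" "D i" ..
  define \<psi> where "\<psi> p = Y (fst p) \<bullet> (G i (x t i (fst p)) (snd p) - f' i (x t i (fst p)))" for p
  have \<psi>: "\<psi> \<in> borel_measurable (others t i \<Otimes>\<^sub>M D i)"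
    unfolding \<psi>_def[abs_def]
    using measurable_oracle_error[OF i] measurable_compose[OF measurable_fst Y] by measurable
  have pair: "(\<lambda>\<omega>. (\<omega>, \<xi> t i \<omega>)) \<in> M \<rightarrow>\<^sub>M others t i \<Otimes>\<^sub>M D i"
    using measurable_others_id measurable_sample[OF i] by (rule measurable_Pair)
  have Y_noise: "Y \<omega> \<bullet> noise t i \<omega> = \<psi> (\<omega>, \<xi> t i \<omega>)" for \<omega>
    by (simp add: \<psi>_def noise_def g_def h_def)
  have "integrable M (\<lambda>\<omega>. \<psi> (\<omega>, \<xi> t i \<omega>))"
    using integrable_inner_square_integrable[OF sq noise_second_moment(1)[OF i, of t]]
    by (simp add: Y_noise)
  then have int: "integrable (distr M (others t i) (\<lambda>\<omega>. \<omega>) \<Otimes>\<^sub>M D i) \<psi>"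
    unfolding joint_distr_sample[OF i, symmetric] using pair \<psi> by (simp add: integrable_distr_eq)
  have "expectation (\<lambda>\<omega>. Y \<omega> \<bullet> noise t i \<omega>) = integral\<^sup>L (distr M (others t i) (\<lambda>\<omega>. \<omega>) \<Otimes>\<^sub>M D i) \<psi>"
    unfolding joint_distr_sample[OF i, symmetric] Y_noise using pair \<psi> by (simp add: integral_distr)
  also have "\<dots> = (\<integral>\<omega>. (\<integral>z. \<psi> (\<omega>, z) \<partial>D i) \<partial>distr M (others t i) (\<lambda>\<omega>. \<omega>))"
    using PD.integral_fst'[OF int] by simp
  also have "(\<lambda>\<omega>. \<integral>z. \<psi> (\<omega>, z) \<partial>D i) = (\<lambda>\<omega>. 0)"
  proof
    fix \<omega>
    have "has_bochner_integral (D i) (\<lambda>z. G i (x t i \<omega>) z - f' i (x t i \<omega>)) (f' i (x t i \<omega>) - f' i (x t i \<omega>))"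
      unfolding G_def
      using has_bochner_integral_diff[OF unbiased[OF i, of "x t i \<omega>"], of "\<lambda>_. f' i (x t i \<omega>)" "f' i (x t i \<omega>)"]
      by (simp add: has_bochner_integral_iff D.prob_space)
    then have "has_bochner_integral (D i) (\<lambda>z. Y \<omega> \<bullet> (G i (x t i \<omega>) z - f' i (x t i \<omega>))) (Y \<omega> \<bullet> 0)"
      by (intro has_bochner_integral_inner_right) auto
    then show "(\<integral>z. \<psi> (\<omega>, z) \<partial>D i) = 0"
      by (simp add: \<psi>_def has_bochner_integral_iff)
  qed
  finally show ?thesis by simp
qed

section \<open>Second moments of gradients and noise\<close>
lemma square_integrable_state:
  assumes "i \<in> {1..N}"
  shows "square_integrable M (u t i) \<and> square_integrable M (x t i)"
  using assms
proof (induction t arbitrary: i)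
  case 0
  then show ?case
    unfolding u_0[abs_def] x_0[abs_def] by (simp add: square_integrable_const)
next
  case (Suc t)
  have g: "square_integrable M (g t j)" if "j \<in> {1..N}" for j
  proof -
    have "square_integrable M (\<lambda>\<omega>. noise t j \<omega> + f' j (x t j \<omega>))"
      using Suc.IH[OF that]
      by (intro square_integrable_add noise_second_moment(1)[OF that]
          square_integrable_lipschitz[OF smooth_Lipschitz[OF that]]) simp
    then show ?thesis by (simp add: noise_def h_def)
  qed
  have u: "square_integrable M (\<lambda>\<omega>. \<beta> *\<^sub>R u t j \<omega> + g t j \<omega>)" if "j \<in> {1..N}" for j
    using g[OF that] Suc.IH[OF that] by (intro square_integrable_add square_integrable_scaleR) auto
  have x: "square_integrable M (\<lambda>\<omega>. x t j \<omega> - \<gamma> *\<^sub>R (\<beta> *\<^sub>R u t j \<omega> + g t j \<omega>))" if "j \<in> {1..N}" for j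
    using u[OF that] Suc.IH[OF that] by (intro square_integrable_diff square_integrable_scaleR) auto
  have averages: "square_integrable M (\<lambda>\<omega>. average N (\<lambda>j. \<beta> *\<^sub>R u t j \<omega> + g t j \<omega>))"
    "square_integrable M (\<lambda>\<omega>. average N (\<lambda>j. x t j \<omega> - \<gamma> *\<^sub>R (\<beta> *\<^sub>R u t j \<omega> + g t j \<omega>)))"
    by (intro square_integrable_average u x; assumption)+
  show ?case
    using u[OF Suc.prems] x[OF Suc.prems] averages unfolding u_Suc[abs_def] x_Suc[abs_def]
    by (cases "I dvd Suc t") simp_all
qed

lemma square_integrable_h: "i \<in> {1..N} \<Longrightarrow> square_integrable M (h t i)"
  unfolding h_def[abs_def]
  by (rule square_integrable_lipschitz[OF smooth_Lipschitz]) (simp_all add: square_integrable_state)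

lemma square_integrable_g: "i \<in> {1..N} \<Longrightarrow> square_integrable M (g t i)"
  using square_integrable_add[OF noise_second_moment(1) square_integrable_h, of i i t t]
  by (simp add: noise_def)

text \<open>
  One of the two errors, the earlier one if the times differ, is a function of samples other than
  the one behind the other error.
\<close>
lemma noise_uncorrelated:
  assumes i: "i \<in> {1..N}" and j: "j \<in> {1..N}" and ne: "(s, j) \<noteq> (t, i)"
  shows "expectation (\<lambda>\<omega>. noise s j \<omega> \<bullet> noise t i \<omega>) = 0"
proof -
  have *: "expectation (\<lambda>\<omega>. noise s j \<omega> \<bullet> noise t i \<omega>) = 0"
    if "i \<in> {1..N}" "j \<in> {1..N}" "(s, j) \<noteq> (t, i)" "s \<le> t" for s t i j
    using that
    by (intro noise_orthogonal noise_second_moment(1) measurable_local_gradients(3) measurable_sample_others)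
      auto
  show ?thesis
  proof (cases "s \<le> t")
    case True
    then show ?thesis using *[OF i j ne] by simp
  next
    case False
    then show ?thesis using *[OF j i, of t s] by (simp add: inner_commute)
  qed
qed

lemma expectation_average:
  assumes "\<And>i. i \<in> {1..N} \<Longrightarrow> integrable M (X i)"
  shows "expectation (\<lambda>\<omega>. average N (\<lambda>i. X i \<omega>)) = average N (\<lambda>i. expectation (X i))"
  unfolding average_def using assms by (simp add: Bochner_Integration.integral_sum)

lemma integrable_average:
  assumes "\<And>i. i \<in> {1..N} \<Longrightarrow> integrable M (X i)"
  shows "integrable M (\<lambda>\<omega>. average N (\<lambda>i. X i \<omega>) :: real)"
  unfolding average_def using assms by (intro integrable_scaleR_right Bochner_Integration.integrable_sum)

lemma weighted_noise_bound:
  assumes i: "i \<in> {1..N}"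
  shows "expectation (\<lambda>\<omega>. (norm (\<Sum>k<n. sample_path.memory_weight (n - k) *\<^sub>R noise (s + k) i \<omega>))\<^sup>2)
    \<le> real n * \<sigma>\<^sup>2 / (1 - \<beta>)\<^sup>2"
proof -
  let ?w = "\<lambda>k. sample_path.memory_weight (n - k)"
  have "expectation (\<lambda>\<omega>. (norm (\<Sum>k<n. ?w k *\<^sub>R noise (s + k) i \<omega>))\<^sup>2)
      = (\<Sum>k<n. expectation (\<lambda>\<omega>. (norm (?w k *\<^sub>R noise (s + k) i \<omega>))\<^sup>2))"
    using i by (intro integral_norm_sum_square_orthogonal square_integrable_scaleR noise_second_moment(1))
      (auto simp: noise_uncorrelated)
  also have "\<dots> = (\<Sum>k<n. (?w k)\<^sup>2 * expectation (\<lambda>\<omega>. (norm (noise (s + k) i \<omega>))\<^sup>2))"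
    by (simp add: power_mult_distrib)
  also have "\<dots> \<le> (\<Sum>k<n. 1 / (1 - \<beta>)\<^sup>2 * \<sigma>\<^sup>2)"
    using noise_second_moment(2)[OF i] sample_path.memory_weight_square_le
    by (intro sum_mono mult_mono) auto
  finally show ?thesis by simp
qed

lemma average_noise_bound:
  "expectation (\<lambda>\<omega>. (norm (average N (\<lambda>i. noise t i \<omega>)))\<^sup>2) \<le> \<sigma>\<^sup>2 / real N"
proof -
  have "expectation (\<lambda>\<omega>. (norm (average N (\<lambda>i. noise t i \<omega>)))\<^sup>2)
      = expectation (\<lambda>\<omega>. (norm (\<Sum>i=1..N. noise t i \<omega>))\<^sup>2) / (real N)\<^sup>2"
    by (simp add: average_def power_mult_distrib power_inverse divide_inverse mult.commute)
  also have "expectation (\<lambda>\<omega>. (norm (\<Sum>i=1..N. noise t i \<omega>))\<^sup>2)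
      = (\<Sum>i=1..N. expectation (\<lambda>\<omega>. (norm (noise t i \<omega>))\<^sup>2))"
    by (intro integral_norm_sum_square_orthogonal noise_second_moment(1)) (auto simp: noise_uncorrelated)
  also have "\<dots> / (real N)\<^sup>2 \<le> (\<Sum>i=1..N. \<sigma>\<^sup>2) / (real N)\<^sup>2"
    by (intro divide_right_mono sum_mono noise_second_moment(2)) auto
  also have "\<dots> = \<sigma>\<^sup>2 / real N"
    using N by (simp add: power2_eq_square)
  finally show ?thesis .
qed

lemma expectation_inner_average_gradient:
  assumes Y: "\<And>i. i \<in> {1..N} \<Longrightarrow> Y \<in> borel_measurable (others t i)" and sq: "square_integrable M Y"
  shows "expectation (\<lambda>\<omega>. Y \<omega> \<bullet> average N (\<lambda>i. g t i \<omega>)) = expectation (\<lambda>\<omega>. Y \<omega> \<bullet> average N (\<lambda>i. h t i \<omega>))"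
proof -
  have "expectation (\<lambda>\<omega>. Y \<omega> \<bullet> average N (\<lambda>i. noise t i \<omega>)) = average N (\<lambda>i. expectation (\<lambda>\<omega>. Y \<omega> \<bullet> noise t i \<omega>))"
    unfolding average_inner[symmetric]
    by (intro expectation_average integrable_inner_square_integrable sq noise_second_moment(1))
  also have "\<dots> = average N (\<lambda>i. 0)"
    by (intro average_cong noise_orthogonal Y sq)
  finally have zero: "expectation (\<lambda>\<omega>. Y \<omega> \<bullet> average N (\<lambda>i. noise t i \<omega>)) = 0"
    by (simp add: average_def)
  have "expectation (\<lambda>\<omega>. Y \<omega> \<bullet> average N (\<lambda>i. g t i \<omega>))
      = expectation (\<lambda>\<omega>. Y \<omega> \<bullet> average N (\<lambda>i. h t i \<omega>) + Y \<omega> \<bullet> average N (\<lambda>i. noise t i \<omega>))"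
    by (simp add: noise_def average_diff inner_diff_right)
  also have "\<dots> = expectation (\<lambda>\<omega>. Y \<omega> \<bullet> average N (\<lambda>i. h t i \<omega>)) + 0"
    using sq unfolding zero[symmetric]
    by (intro Bochner_Integration.integral_add integrable_inner_square_integrable square_integrable_average
        square_integrable_h noise_second_moment(1))
  finally show ?thesis by simp
qed

lemma measurable_h_others:
  assumes "i \<in> {1..N}"
  shows "h t i \<in> borel_measurable (others t j)"
  unfolding h_def[abs_def]
  using measurable_compose[OF measurable_x_others borel_measurable_local_gradient] assms by blast

text \<open>
  The mean noise is orthogonal to the mean of the local gradients, which is a function of past
  samples only.
\<close>
lemma expectation_average_gradient_square_le:
  "expectation (\<lambda>\<omega>. (norm (average N (\<lambda>i. g t i \<omega>)))\<^sup>2)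
    \<le> expectation (\<lambda>\<omega>. (norm (average N (\<lambda>i. h t i \<omega>)))\<^sup>2) + \<sigma>\<^sup>2 / real N"
proof -
  let ?g = "\<lambda>\<omega>. average N (\<lambda>i. g t i \<omega>)" and ?h = "\<lambda>\<omega>. average N (\<lambda>i. h t i \<omega>)"
    and ?n = "\<lambda>\<omega>. average N (\<lambda>i. noise t i \<omega>)"
  have sq: "square_integrable M ?g" "square_integrable M ?h" "square_integrable M ?n"
    by (intro square_integrable_average square_integrable_g square_integrable_h noise_second_moment(1); assumption)+
  have "(\<lambda>\<omega>. (norm (?g \<omega>))\<^sup>2) = (\<lambda>\<omega>. (2 * (?h \<omega> \<bullet> ?g \<omega>) - (norm (?h \<omega>))\<^sup>2) + (norm (?n \<omega>))\<^sup>2)"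
  proof
    fix \<omega>
    have "?n \<omega> = ?g \<omega> - ?h \<omega>" by (simp add: noise_def average_diff)
    then show "(norm (?g \<omega>))\<^sup>2 = (2 * (?h \<omega> \<bullet> ?g \<omega>) - (norm (?h \<omega>))\<^sup>2) + (norm (?n \<omega>))\<^sup>2"
      by (simp add: power2_norm_eq_inner inner_diff_left inner_diff_right inner_commute)
  qed
  then have "expectation (\<lambda>\<omega>. (norm (?g \<omega>))\<^sup>2)
      = 2 * expectation (\<lambda>\<omega>. ?h \<omega> \<bullet> ?g \<omega>) - expectation (\<lambda>\<omega>. (norm (?h \<omega>))\<^sup>2) + expectation (\<lambda>\<omega>. (norm (?n \<omega>))\<^sup>2)"
    using sq by (simp add: square_integrable_norm_square integrable_inner_square_integrable)
  moreover have "expectation (\<lambda>\<omega>. ?h \<omega> \<bullet> ?g \<omega>) = expectation (\<lambda>\<omega>. (norm (?h \<omega>))\<^sup>2)"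
    unfolding power2_norm_eq_inner
    by (intro expectation_inner_average_gradient sq(2) borel_measurable_average measurable_h_others)
  ultimately show ?thesis
    using average_noise_bound[of t] by simp
qed

section \<open>Deviation of the workers from their mean\<close>
definition consensus_error :: "nat \<Rightarrow> 'w \<Rightarrow> real" where
  "consensus_error t \<omega> = average N (\<lambda>i. (norm (x t i \<omega> - sample_path.xbar \<omega> t))\<^sup>2)"

lemma square_integrable_xbar: "square_integrable M (\<lambda>\<omega>. sample_path.xbar \<omega> t)"
  using square_integrable_state by (intro square_integrable_average) auto

lemma square_integrable_ubar: "square_integrable M (\<lambda>\<omega>. sample_path.ubar \<omega> t)"
  using square_integrable_state by (intro square_integrable_average) auto

lemma integrable_consensus_error: "integrable M (consensus_error t)"
  unfolding consensus_error_def[abs_def]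
  using square_integrable_state square_integrable_xbar
  by (intro integrable_average square_integrable_norm_square square_integrable_diff) auto

lemma average_local_gradient_lipschitz:
  "average N (\<lambda>i. (norm (h t i \<omega> - f' i (sample_path.xbar \<omega> t)))\<^sup>2) \<le> L\<^sup>2 * consensus_error t \<omega>"
  unfolding consensus_error_def average_mult[symmetric]
proof (rule average_mono)
  fix i assume "i \<in> {1..N}"
  from lipschitz_onD[OF smooth_Lipschitz[OF this], of "x t i \<omega>" "sample_path.xbar \<omega> t"]
  have "norm (h t i \<omega> - f' i (sample_path.xbar \<omega> t)) \<le> L * norm (x t i \<omega> - sample_path.xbar \<omega> t)"
    by (simp add: h_def dist_norm)
  then have "(norm (h t i \<omega> - f' i (sample_path.xbar \<omega> t)))\<^sup>2 \<le> (L * norm (x t i \<omega> - sample_path.xbar \<omega> t))\<^sup>2"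
    by (intro power_mono) auto
  then show "(norm (h t i \<omega> - f' i (sample_path.xbar \<omega> t)))\<^sup>2 \<le> L\<^sup>2 * (norm (x t i \<omega> - sample_path.xbar \<omega> t))\<^sup>2"
    by (simp add: power_mult_distrib)
qed

lemma gradient_at_mean_approx:
  "(norm (fbar' (sample_path.xbar \<omega> t) - average N (\<lambda>i. h t i \<omega>)))\<^sup>2 \<le> L\<^sup>2 * consensus_error t \<omega>"
proof -
  have "(norm (fbar' (sample_path.xbar \<omega> t) - average N (\<lambda>i. h t i \<omega>)))\<^sup>2
      = (norm (average N (\<lambda>i. h t i \<omega> - f' i (sample_path.xbar \<omega> t))))\<^sup>2"
    by (simp add: average_diff global_gradient_eq norm_minus_commute)
  also have "\<dots> \<le> average N (\<lambda>i. (norm (h t i \<omega> - f' i (sample_path.xbar \<omega> t)))\<^sup>2)"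
    using N by (rule norm_average_square_le)
  finally show ?thesis
    using average_local_gradient_lipschitz[of t \<omega>] by linarith
qed

text \<open>
  The mean of the local gradients minimizes the average squared deviation, so it may be replaced by the
  global gradient at the mean iterate, to which the dissimilarity assumption applies.
\<close>
lemma local_gradient_dispersion:
  "average N (\<lambda>i. (norm (h t i \<omega> - average N (\<lambda>i. h t i \<omega>)))\<^sup>2) \<le> 2 * L\<^sup>2 * consensus_error t \<omega> + 2 * \<kappa>\<^sup>2"
proof -
  let ?y = "sample_path.xbar \<omega> t"
  have "average N (\<lambda>i. (norm (h t i \<omega> - average N (\<lambda>i. h t i \<omega>)))\<^sup>2) \<le> average N (\<lambda>i. (norm (h t i \<omega> - fbar' ?y))\<^sup>2)"
    using N by (rule average_square_deviation_le)
  also have "\<dots> \<le> average N (\<lambda>i. 2 * (norm (h t i \<omega> - f' i ?y))\<^sup>2 + 2 * (norm (f' i ?y - fbar' ?y))\<^sup>2)"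
    using norm_add_square_le[of "h t i \<omega> - f' i ?y" "f' i ?y - fbar' ?y" for i]
    by (intro average_mono) simp
  also have "\<dots> = 2 * average N (\<lambda>i. (norm (h t i \<omega> - f' i ?y))\<^sup>2) + 2 * average N (\<lambda>i. (norm (f' i ?y - fbar' ?y))\<^sup>2)"
    by (simp add: average_add average_mult)
  finally show ?thesis
    using average_local_gradient_lipschitz[of t \<omega>] dissimilarity_bound[of ?y] by linarith
qed

text \<open>
  Let \<open>p\<close> and \<open>r\<close> denote the \<open>\<sigma>\<close>- and \<open>\<kappa>\<close>-terms with constant \<open>1\<close>. If earlier errors are at most \<open>A\<close>,
  the current one is at most \<open>2 p + 4 r + 4 e A\<close>, where \<open>e = (L \<gamma> I / (1 - \<beta>))\<^sup>2\<close>. The condition on \<open>I\<close>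
  gives \<open>e \<le> 1 / 36\<close>, so the bound \<open>A = 4 p + 9 r\<close> reproduces itself.
\<close>
lemma expectation_consensus_error_le:
  assumes sync: "real I \<le> (1 - \<beta>) / (6 * L * \<gamma>)"
  shows "expectation (consensus_error t)
    \<le> 4 * \<gamma>\<^sup>2 * real I * \<sigma>\<^sup>2 / (1 - \<beta>)\<^sup>2 + 9 * \<gamma>\<^sup>2 * (real I)\<^sup>2 * \<kappa>\<^sup>2 / (1 - \<beta>)\<^sup>2" (is "_ \<le> ?A")
proof (induction t rule: less_induct)
  case (less t)
  \<comment> \<open>the last synchronization up to time \<open>t\<close> is at time \<open>s\<close>\<close>
  define n where "n = t mod I"
  define s where "s = t - n"
  have n: "n < I" using I by (simp add: n_def)
  have s: "I dvd s" by (simp add: s_def n_def minus_mod_eq_mult_div)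
  have t: "t = s + n" by (simp add: s_def n_def)
  \<comment> \<open>the factor of the gradient dispersion in \<open>average_square_deviation_split\<close>\<close>
  define c where "c = 2 * \<gamma>\<^sup>2 * real n / (1 - \<beta>)\<^sup>2"
  have c: "0 \<le> c" by (simp add: c_def)
  let ?S = "\<lambda>i \<omega>. (norm (\<Sum>k<n. sample_path.memory_weight (n - k) *\<^sub>R noise (s + k) i \<omega>))\<^sup>2"
  let ?B = "\<lambda>\<omega>. 2 * \<gamma>\<^sup>2 * average N (\<lambda>i. ?S i \<omega>) + c * (\<Sum>k<n. 2 * L\<^sup>2 * consensus_error (s + k) \<omega> + 2 * \<kappa>\<^sup>2)"
  have S: "integrable M (?S i)" if "i \<in> {1..N}" for i
    using that by (intro square_integrable_norm_square square_integrable_sum square_integrable_scaleR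
        noise_second_moment(1))
  have path: "consensus_error t \<omega> \<le> ?B \<omega>" for \<omega>
  proof -
    have "consensus_error t \<omega> \<le> 2 * \<gamma>\<^sup>2 * average N (\<lambda>i. ?S i \<omega>)
        + c * (\<Sum>k<n. average N (\<lambda>i. (norm (h (s + k) i \<omega> - average N (\<lambda>i. h (s + k) i \<omega>)))\<^sup>2))"
      unfolding consensus_error_def t c_def noise_def
      by (rule sample_path.average_square_deviation_split[OF s n, where h = "\<lambda>t i. h t i \<omega>"])
    also have "\<dots> \<le> ?B \<omega>"
      using c by (intro add_left_mono mult_left_mono sum_mono local_gradient_dispersion)
    finally show ?thesis .
  qed
  have "expectation (consensus_error t) \<le> expectation ?B"
    using path S
    by (intro integral_mono integrable_consensus_error Bochner_Integration.integrable_add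
        integrable_mult_right Bochner_Integration.integrable_sum integrable_average) auto
  also have "\<dots> = 2 * \<gamma>\<^sup>2 * average N (\<lambda>i. expectation (?S i))
      + c * (\<Sum>k<n. 2 * L\<^sup>2 * expectation (consensus_error (s + k)) + 2 * \<kappa>\<^sup>2)"
  proof -
    have "integrable M (\<lambda>\<omega>. average N (\<lambda>i. ?S i \<omega>))"
      "expectation (\<lambda>\<omega>. average N (\<lambda>i. ?S i \<omega>)) = average N (\<lambda>i. expectation (?S i))"
      by (intro integrable_average expectation_average S; assumption)+
    then show ?thesis
      by (simp add: integrable_consensus_error Bochner_Integration.integral_sum prob_space)
  qed
  also have "\<dots> \<le> 2 * \<gamma>\<^sup>2 * average N (\<lambda>i. real I * \<sigma>\<^sup>2 / (1 - \<beta>)\<^sup>2) + c * (\<Sum>k<n. 2 * L\<^sup>2 * ?A + 2 * \<kappa>\<^sup>2)"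
  proof (intro add_mono mult_left_mono sum_mono average_mono)
    fix i assume "i \<in> {1..N}"
    from weighted_noise_bound[OF this, of n s]
    show "expectation (?S i) \<le> real I * \<sigma>\<^sup>2 / (1 - \<beta>)\<^sup>2"
      by (rule order_trans) (use n in \<open>auto intro!: divide_right_mono mult_right_mono\<close>)
  next
    fix k assume "k \<in> {..<n}"
    then show "expectation (consensus_error (s + k)) \<le> ?A"
      by (intro less) (simp add: t)
  qed (use c in auto)
  also have "\<dots> = 2 * \<gamma>\<^sup>2 * (real I * \<sigma>\<^sup>2 / (1 - \<beta>)\<^sup>2) + 2 * \<gamma>\<^sup>2 * (real n)\<^sup>2 / (1 - \<beta>)\<^sup>2 * (2 * L\<^sup>2 * ?A + 2 * \<kappa>\<^sup>2)"
    using N by (simp add: average_const c_def power2_eq_square)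
  also have "\<dots> \<le> 2 * \<gamma>\<^sup>2 * (real I * \<sigma>\<^sup>2 / (1 - \<beta>)\<^sup>2) + 2 * \<gamma>\<^sup>2 * (real I)\<^sup>2 / (1 - \<beta>)\<^sup>2 * (2 * L\<^sup>2 * ?A + 2 * \<kappa>\<^sup>2)"
    using n by (intro add_left_mono mult_right_mono divide_right_mono mult_left_mono power_mono) auto
  also have "\<dots> \<le> ?A"
  proof -
    define p where "p = \<gamma>\<^sup>2 * real I * \<sigma>\<^sup>2 / (1 - \<beta>)\<^sup>2"
    define r where "r = \<gamma>\<^sup>2 * (real I)\<^sup>2 * \<kappa>\<^sup>2 / (1 - \<beta>)\<^sup>2"
    define e where "e = L\<^sup>2 * \<gamma>\<^sup>2 * (real I)\<^sup>2 / (1 - \<beta>)\<^sup>2"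
    have "L * \<gamma> * real I \<le> (1 - \<beta>) / 6"
      using sync L \<gamma> by (simp add: pos_le_divide_eq mult_ac)
    then have "(L * \<gamma> * real I)\<^sup>2 \<le> ((1 - \<beta>) / 6)\<^sup>2"
      using L \<gamma> by (intro power_mono) auto
    then have e: "e \<le> 1 / 36"
      using \<beta> by (simp add: e_def pos_divide_le_eq power_mult_distrib power_divide)
    have "0 \<le> p" "0 \<le> r" by (simp_all add: p_def r_def)
    then have "0 \<le> 4 * p + 9 * r" by simp
    then have "e * (4 * p + 9 * r) \<le> 1 / 36 * (4 * p + 9 * r)"
      by (rule mult_right_mono[OF e])
    then have "2 * p + 4 * r + 4 * (e * (4 * p + 9 * r)) \<le> 4 * p + 9 * r"
      using \<open>0 \<le> p\<close> \<open>0 \<le> r\<close> by simp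
    moreover have "?A = 4 * p + 9 * r"
      by (simp add: p_def r_def)
    moreover have "2 * \<gamma>\<^sup>2 * (real I * \<sigma>\<^sup>2 / (1 - \<beta>)\<^sup>2) = 2 * p"
      by (simp add: p_def)
    moreover have "2 * \<gamma>\<^sup>2 * (real I)\<^sup>2 / (1 - \<beta>)\<^sup>2 * (2 * L\<^sup>2 * B + 2 * \<kappa>\<^sup>2) = 4 * (e * B) + 4 * r" for B
      by (simp add: e_def r_def distrib_left add_divide_distrib mult_ac)
    ultimately show ?thesis by simp
  qed
  finally show ?case .
qed

end

section \<open>The convergence bound\<close>

text \<open>
  Elimination of the intermediate sums. \<open>P\<close>, \<open>Hs\<close>, \<open>Gs\<close> and \<open>Us\<close> stand for the summed second moments of
  the gradient at the mean iterate, the mean local gradient, the mean stochastic gradient and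
  the mean momentum; \<open>v\<close> is the variance of the mean noise and \<open>A\<close> the consensus bound. With
  \<open>m = L \<gamma> / q\<^sup>2\<close> the coefficient of \<open>Hs\<close> is \<open>m (1 + \<beta>) - 1\<close> up to a positive factor, and the step size
  condition says that this is nonpositive.
\<close>
lemma combine_sgdm_bounds:
  fixes P Hs Gs Us :: real
  assumes q: "0 < q" and \<beta>: "\<beta> = 1 - q" "0 \<le> \<beta>" and \<gamma>: "0 < \<gamma>" and L: "0 < L" and T: "0 < T"
    and step: "\<gamma> \<le> q\<^sup>2 / ((1 + \<beta>) * L)" and Hs: "0 \<le> Hs"
    and descent: "- \<Delta> \<le> L * \<gamma>\<^sup>2 / (2 * q\<^sup>2) * Gs + \<gamma> / q * (- P / 2 - Hs / 2 + L\<^sup>2 * A * T / 2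
      + L * \<beta> * \<gamma> / 2 * Us + L * \<beta> * \<gamma> / (2 * q\<^sup>2) * Hs)"
    and momentum: "Us \<le> Gs / q\<^sup>2" and variance: "Gs \<le> Hs + T * v"
  shows "P / T \<le> 2 * q / (\<gamma> * T) * \<Delta> + L * \<gamma> / q\<^sup>2 * v + L\<^sup>2 * A"
proof -
  \<comment> \<open>scaling by \<open>2 q / \<gamma>\<close> turns every coefficient into a multiple of \<open>m\<close>\<close>
  define m where "m = L * \<gamma> / q\<^sup>2"
  have m: "0 \<le> m" using L \<gamma> by (simp add: m_def)
  have m_le: "m * (1 + \<beta>) \<le> 1"
    using step q L \<beta>(2) by (simp add: m_def pos_le_divide_eq pos_divide_le_eq mult_ac)
  have L\<gamma>: "L * \<gamma> = m * q\<^sup>2" using q by (simp add: m_def)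
  have "2 * q / \<gamma> * (- \<Delta>) \<le> 2 * q / \<gamma> * (L * \<gamma>\<^sup>2 / (2 * q\<^sup>2) * Gs + \<gamma> / q * (- P / 2 - Hs / 2
      + L\<^sup>2 * A * T / 2 + L * \<beta> * \<gamma> / 2 * Us + L * \<beta> * \<gamma> / (2 * q\<^sup>2) * Hs))"
    using q \<gamma> by (intro mult_left_mono[OF descent]) simp
  also have "\<dots> = 2 * q / \<gamma> * (L * \<gamma>\<^sup>2 / (2 * q\<^sup>2)) * Gs + 2 * q / \<gamma> * (\<gamma> / q) * (- P / 2 - Hs / 2
      + L\<^sup>2 * A * T / 2 + L * \<beta> * \<gamma> / 2 * Us + L * \<beta> * \<gamma> / (2 * q\<^sup>2) * Hs)"
    by (simp only: distrib_left mult.assoc)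
  also have "2 * q / \<gamma> * (L * \<gamma>\<^sup>2 / (2 * q\<^sup>2)) = m * q"
    using q \<gamma> by (simp add: m_def power2_eq_square)
  also have "2 * q / \<gamma> * (\<gamma> / q) = 2"
    using q \<gamma> by simp
  also have "L * \<beta> * \<gamma> / 2 * Us = \<beta> * (m * (q\<^sup>2 * Us)) / 2"
    using L\<gamma> by (simp add: mult_ac)
  also have "L * \<beta> * \<gamma> / (2 * q\<^sup>2) * Hs = \<beta> * (m * Hs) / 2"
    by (simp add: m_def mult_ac)
  finally have "- (2 * q / \<gamma> * \<Delta>) \<le> m * q * Gs - P - Hs + L\<^sup>2 * A * T + \<beta> * (m * (q\<^sup>2 * Us)) + \<beta> * (m * Hs)"
    by (simp add: algebra_simps)
  moreover have "\<beta> * (m * (q\<^sup>2 * Us)) \<le> \<beta> * (m * Gs)"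
    using momentum q m \<beta>(2) by (intro mult_left_mono) (auto simp: pos_le_divide_eq mult.commute)
  moreover have "m * q * Gs + \<beta> * (m * Gs) = m * Gs"
    by (simp add: \<beta>(1) algebra_simps)
  moreover have "m * Gs \<le> m * (Hs + T * v)"
    using variance m by (rule mult_left_mono)
  moreover have "m * (Hs + T * v) + \<beta> * (m * Hs) - Hs \<le> m * (T * v)"
    using mult_right_mono[OF m_le Hs] by (simp add: algebra_simps)
  ultimately have "P \<le> 2 * q / \<gamma> * \<Delta> + m * (T * v) + L\<^sup>2 * A * T"
    by linarith
  then have "P / T \<le> (2 * q / \<gamma> * \<Delta> + m * (T * v) + L\<^sup>2 * A * T) / T"
    using T by (intro divide_right_mono) auto
  also have "\<dots> = 2 * q / (\<gamma> * T) * \<Delta> + m * v + L\<^sup>2 * A"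
    using T by (simp add: add_divide_distrib)
  finally show ?thesis by (simp add: m_def)
qed

context pr_sgdm
begin

lemma square_integrable_aux_iterate: "square_integrable M (\<lambda>\<omega>. sample_path.aux_iterate \<omega> t)"
  unfolding sample_path.aux_iterate_def
  by (intro square_integrable_diff square_integrable_scaleR square_integrable_xbar square_integrable_ubar)

lemma measurable_aux_iterate_others: "(\<lambda>\<omega>. sample_path.aux_iterate \<omega> t) \<in> borel_measurable (others t i)"
proof -
  have "u t j \<in> borel_measurable (others t i)" "x t j \<in> borel_measurable (others t i)" if "j \<in> {1..N}" for j
    using measurable_state[OF _ that, of t "others t i"] measurable_sample_others[of _ _ t i] by auto
  then show ?thesis
    unfolding sample_path.aux_iterate_def
    by (intro borel_measurable_diff borel_measurable_scaleR borel_measurable_const borel_measurable_average)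
qed

lemma square_integrable_global_gradient:
  "square_integrable M X \<Longrightarrow> square_integrable M (\<lambda>\<omega>. fbar' (X \<omega>))"
  using global_Lipschitz by (rule square_integrable_lipschitz)

theorem average_gradient_norm_le:
  assumes step: "\<gamma> \<le> (1 - \<beta>)\<^sup>2 / ((1 + \<beta>) * L)" and sync: "real I \<le> (1 - \<beta>) / (6 * L * \<gamma>)"
    and minimum: "\<And>y. fstar \<le> fbar y" and T: "1 \<le> T"
  shows "(\<Sum>t<T. expectation (\<lambda>\<omega>. (norm (fbar' (sample_path.xbar \<omega> t)))\<^sup>2)) / real T
    \<le> sgdm_bound L \<beta> (fbar x0 - fstar) N T I \<gamma> \<sigma> \<kappa>"
proof -
  define q where "q = 1 - \<beta>"
  define A where "A = 4 * \<gamma>\<^sup>2 * real I * \<sigma>\<^sup>2 / q\<^sup>2 + 9 * \<gamma>\<^sup>2 * (real I)\<^sup>2 * \<kappa>\<^sup>2 / q\<^sup>2"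
  have q: "0 < q" using \<beta> by (simp add: q_def)
  let ?gbar = "\<lambda>t \<omega>. average N (\<lambda>i. g t i \<omega>)" and ?hbar = "\<lambda>t \<omega>. average N (\<lambda>i. h t i \<omega>)"
  let ?ubar = "\<lambda>t \<omega>. sample_path.ubar \<omega> t" and ?xbar = "\<lambda>t \<omega>. sample_path.xbar \<omega> t"
  let ?z = "\<lambda>t \<omega>. sample_path.aux_iterate \<omega> t"
  let ?E2 = "\<lambda>X. expectation (\<lambda>\<omega>. (norm (X \<omega> :: 'a))\<^sup>2)"
  have sq: "square_integrable M (?gbar t)" "square_integrable M (?hbar t)" "square_integrable M (?ubar t)"
    "square_integrable M (\<lambda>\<omega>. fbar' (?xbar t \<omega>))" "square_integrable M (\<lambda>\<omega>. fbar' (?z t \<omega>))" for t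
    by (intro square_integrable_average square_integrable_g square_integrable_h square_integrable_ubar
        square_integrable_global_gradient square_integrable_xbar square_integrable_aux_iterate; assumption?)+
  note int [simp] = sq[THEN square_integrable_norm_square]
    integrable_inner_square_integrable[OF sq(5) sq(1)] integrable_inner_square_integrable[OF sq(5) sq(2)]
    integrable_consensus_error

  have "fstar - fbar x0 \<le> (\<Sum>t<T. L * \<gamma>\<^sup>2 / (2 * q\<^sup>2) * (norm (?gbar t \<omega>))\<^sup>2
      - \<gamma> / q * (fbar' (?z t \<omega>) \<bullet> ?gbar t \<omega>))" for \<omega>
    using sample_path.sum_descent[OF GDERIV_global global_Lipschitz, of \<omega> T]
      minimum[of "?z T \<omega>"] by (simp add: q_def)
  then have "expectation (\<lambda>\<omega>. fstar - fbar x0) \<le> expectation (\<lambda>\<omega>. \<Sum>t<T. L * \<gamma>\<^sup>2 / (2 * q\<^sup>2) * (norm (?gbar t \<omega>))\<^sup>2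
      - \<gamma> / q * (fbar' (?z t \<omega>) \<bullet> ?gbar t \<omega>))"
    by (intro integral_mono Bochner_Integration.integrable_sum Bochner_Integration.integrable_diff
        integrable_mult_right) auto
  also have "\<dots> = (\<Sum>t<T. L * \<gamma>\<^sup>2 / (2 * q\<^sup>2) * ?E2 (?gbar t) - \<gamma> / q * expectation (\<lambda>\<omega>. fbar' (?z t \<omega>) \<bullet> ?gbar t \<omega>))"
    by (simp add: Bochner_Integration.integral_sum)
  \<comment> \<open>\<open>z\<close> depends on past samples only, so the noise drops out of the inner product\<close>
  also have "\<dots> = (\<Sum>t<T. L * \<gamma>\<^sup>2 / (2 * q\<^sup>2) * ?E2 (?gbar t) + \<gamma> / q * (- expectation (\<lambda>\<omega>. fbar' (?z t \<omega>) \<bullet> ?hbar t \<omega>)))"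
    using expectation_inner_average_gradient[OF _ sq(5)]
      measurable_compose[OF measurable_aux_iterate_others borel_measurable_global_gradient]
    by simp
  also have "\<dots> \<le> (\<Sum>t<T. L * \<gamma>\<^sup>2 / (2 * q\<^sup>2) * ?E2 (?gbar t) + \<gamma> / q *
      (- ?E2 (\<lambda>\<omega>. fbar' (?xbar t \<omega>)) / 2 - ?E2 (?hbar t) / 2 + L\<^sup>2 * A / 2
        + L * \<beta> * \<gamma> / 2 * ?E2 (?ubar t) + L * \<beta> * \<gamma> / (2 * q\<^sup>2) * ?E2 (?hbar t)))"
  proof (intro sum_mono add_left_mono mult_left_mono)
    fix t
    have "- (fbar' (?z t \<omega>) \<bullet> ?hbar t \<omega>) \<le> - (norm (fbar' (?xbar t \<omega>)))\<^sup>2 / 2 - (norm (?hbar t \<omega>))\<^sup>2 / 2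
        + L\<^sup>2 / 2 * consensus_error t \<omega> + L * \<beta> * \<gamma> / 2 * (norm (?ubar t \<omega>))\<^sup>2
        + L * \<beta> * \<gamma> / (2 * q\<^sup>2) * (norm (?hbar t \<omega>))\<^sup>2" for \<omega>
      using sample_path.gradient_aux_inner_le[OF global_Lipschitz \<gamma>, of \<omega> t "?hbar t \<omega>"]
        gradient_at_mean_approx[of t \<omega>] unfolding q_def by simp
    then have "expectation (\<lambda>\<omega>. - (fbar' (?z t \<omega>) \<bullet> ?hbar t \<omega>))
        \<le> expectation (\<lambda>\<omega>. - (norm (fbar' (?xbar t \<omega>)))\<^sup>2 / 2 - (norm (?hbar t \<omega>))\<^sup>2 / 2
        + L\<^sup>2 / 2 * consensus_error t \<omega> + L * \<beta> * \<gamma> / 2 * (norm (?ubar t \<omega>))\<^sup>2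
        + L * \<beta> * \<gamma> / (2 * q\<^sup>2) * (norm (?hbar t \<omega>))\<^sup>2)"
      by (intro integral_mono) simp_all
    also have "\<dots> = - ?E2 (\<lambda>\<omega>. fbar' (?xbar t \<omega>)) / 2 - ?E2 (?hbar t) / 2
        + L\<^sup>2 / 2 * expectation (consensus_error t) + L * \<beta> * \<gamma> / 2 * ?E2 (?ubar t)
        + L * \<beta> * \<gamma> / (2 * q\<^sup>2) * ?E2 (?hbar t)"
      by simp
    also have "L\<^sup>2 / 2 * expectation (consensus_error t) \<le> L\<^sup>2 / 2 * A"
      using expectation_consensus_error_le[OF sync, of t]
      by (intro mult_left_mono) (simp_all add: A_def q_def)
    finally show "- expectation (\<lambda>\<omega>. fbar' (?z t \<omega>) \<bullet> ?hbar t \<omega>)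
        \<le> - ?E2 (\<lambda>\<omega>. fbar' (?xbar t \<omega>)) / 2 - ?E2 (?hbar t) / 2 + L\<^sup>2 * A / 2
        + L * \<beta> * \<gamma> / 2 * ?E2 (?ubar t) + L * \<beta> * \<gamma> / (2 * q\<^sup>2) * ?E2 (?hbar t)"
      by simp
  qed (use q \<gamma> in simp)
  also have "\<dots> = L * \<gamma>\<^sup>2 / (2 * q\<^sup>2) * (\<Sum>t<T. ?E2 (?gbar t)) + \<gamma> / q *
      (- (\<Sum>t<T. ?E2 (\<lambda>\<omega>. fbar' (?xbar t \<omega>))) / 2 - (\<Sum>t<T. ?E2 (?hbar t)) / 2 + L\<^sup>2 * A * real T / 2
        + L * \<beta> * \<gamma> / 2 * (\<Sum>t<T. ?E2 (?ubar t)) + L * \<beta> * \<gamma> / (2 * q\<^sup>2) * (\<Sum>t<T. ?E2 (?hbar t)))"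
    by (simp only: sum.distrib sum_subtractf sum_negf sum_distrib_left[symmetric] sum_divide_distrib[symmetric]
        sum_constant card_lessThan) simp
  finally have descent: "- (fbar x0 - fstar) \<le> \<dots>"
    by (simp add: prob_space)

  have "(\<Sum>t<T. ?E2 (?ubar t)) = expectation (\<lambda>\<omega>. \<Sum>t<T. (norm (?ubar t \<omega>))\<^sup>2)"
    by (simp add: Bochner_Integration.integral_sum)
  also have "\<dots> \<le> expectation (\<lambda>\<omega>. (\<Sum>t<T. (norm (?gbar t \<omega>))\<^sup>2) / q\<^sup>2)"
    unfolding q_def using sample_path.sum_norm_ubar_square_le
    by (intro integral_mono Bochner_Integration.integrable_sum integrable_divide) auto
  also have "\<dots> = (\<Sum>t<T. ?E2 (?gbar t)) / q\<^sup>2"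
    by (simp add: Bochner_Integration.integral_sum)
  finally have momentum: "(\<Sum>t<T. ?E2 (?ubar t)) \<le> (\<Sum>t<T. ?E2 (?gbar t)) / q\<^sup>2" .

  have "(\<Sum>t<T. ?E2 (?gbar t)) \<le> (\<Sum>t<T. ?E2 (?hbar t) + \<sigma>\<^sup>2 / real N)"
    by (intro sum_mono expectation_average_gradient_square_le)
  then have variance: "(\<Sum>t<T. ?E2 (?gbar t)) \<le> (\<Sum>t<T. ?E2 (?hbar t)) + real T * (\<sigma>\<^sup>2 / real N)"
    by (simp add: sum.distrib)

  have "(\<Sum>t<T. ?E2 (\<lambda>\<omega>. fbar' (?xbar t \<omega>))) / real T
      \<le> 2 * q / (\<gamma> * real T) * (fbar x0 - fstar) + L * \<gamma> / q\<^sup>2 * (\<sigma>\<^sup>2 / real N) + L\<^sup>2 * A"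
    using q \<beta> \<gamma> L T step descent momentum variance
    by (intro combine_sgdm_bounds[where \<beta> = \<beta>]) (auto simp: q_def intro!: sum_nonneg)
  then show ?thesis
    by (simp add: sgdm_bound_def A_def q_def distrib_left mult_ac)
qed

end

lemma sgdm_bound_rate_holds:
  assumes "0 < L" "\<beta> < 1"
  shows "sgdm_bound_rate L \<beta> \<Delta>"
proof -
  let ?P = "principal (admissible_params L \<beta>)"
  define h1 where "h1 = (\<lambda>(N :: nat, T :: nat, I :: nat, \<gamma>, \<sigma> :: real, \<kappa> :: real). 2 * (1 - \<beta>) / (\<gamma> * real T) * \<Delta>)"
  define h2 where "h2 = (\<lambda>(N :: nat, T :: nat, I :: nat, \<gamma>, \<sigma> :: real, \<kappa> :: real). L * \<gamma> / (1 - \<beta>)\<^sup>2 * (\<sigma>\<^sup>2 / real N))"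
  define h3 where "h3 = (\<lambda>(N :: nat, T :: nat, I :: nat, \<gamma>, \<sigma> :: real, \<kappa> :: real). 4 * L\<^sup>2 * \<gamma>\<^sup>2 * real I * \<sigma>\<^sup>2 / (1 - \<beta>)\<^sup>2)"
  define h4 where "h4 = (\<lambda>(N :: nat, T :: nat, I :: nat, \<gamma>, \<sigma> :: real, \<kappa> :: real). 9 * L\<^sup>2 * \<gamma>\<^sup>2 * (real I)\<^sup>2 * \<kappa>\<^sup>2 / (1 - \<beta>)\<^sup>2)"
  have "h1 \<in> O[?P](\<lambda>(N, T, I, \<gamma>, \<sigma>, \<kappa>). 1 / (\<gamma> * real T))"
    by (rule bigoI[where c = "\<bar>2 - 2 * \<beta>\<bar> * \<bar>\<Delta>\<bar>"])
      (auto simp: eventually_principal h1_def abs_mult)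
  moreover have "h2 \<in> O[?P](\<lambda>(N, T, I, \<gamma>, \<sigma>, \<kappa>). \<gamma> / real N * \<sigma>\<^sup>2)"
    by (rule bigoI[where c = "L / (1 - \<beta>)\<^sup>2"])
      (use assms in \<open>auto simp: eventually_principal h2_def abs_mult mult_ac\<close>)
  moreover have "h3 \<in> O[?P](\<lambda>(N, T, I, \<gamma>, \<sigma>, \<kappa>). \<gamma>\<^sup>2 * real I * \<sigma>\<^sup>2)"
    by (rule bigoI[where c = "4 * L\<^sup>2 / (1 - \<beta>)\<^sup>2"])
      (auto simp: eventually_principal h3_def abs_mult mult_ac)
  moreover have "h4 \<in> O[?P](\<lambda>(N, T, I, \<gamma>, \<sigma>, \<kappa>). \<gamma>\<^sup>2 * (real I)\<^sup>2 * \<kappa>\<^sup>2)"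
    by (rule bigoI[where c = "9 * L\<^sup>2 / (1 - \<beta>)\<^sup>2"])
      (auto simp: eventually_principal h4_def abs_mult mult_ac)
  moreover have "\<forall>(N, T, I, \<gamma>, \<sigma>, \<kappa>) \<in> admissible_params L \<beta>. sgdm_bound L \<beta> \<Delta> N T I \<gamma> \<sigma> \<kappa> =
      h1 (N, T, I, \<gamma>, \<sigma>, \<kappa>) + h2 (N, T, I, \<gamma>, \<sigma>, \<kappa>) + h3 (N, T, I, \<gamma>, \<sigma>, \<kappa>) + h4 (N, T, I, \<gamma>, \<sigma>, \<kappa>)"
    by (auto simp: sgdm_bound_def h1_def h2_def h3_def h4_def)
  ultimately show ?thesis
    unfolding sgdm_bound_rate_def Let_def by blast
qed

theorem theorem1:
  fixes N I :: nat
    and D :: "nat \<Rightarrow> 'd measure"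
    and F :: "nat \<Rightarrow> real ^ 'm \<Rightarrow> 'd \<Rightarrow> real"
    and M :: "'w measure"
    and \<xi> :: "nat \<Rightarrow> nat \<Rightarrow> 'w \<Rightarrow> 'd"
    and x0 :: "real ^ 'm"
    and L \<sigma> \<kappa> \<beta> \<gamma> fstar :: real
  defines "f \<equiv> local_objective D F"
    and "fbar \<equiv> global_objective N D F"
    and "xbar \<equiv> (\<lambda>t \<omega>. mean_iterate N F \<beta> \<gamma> I x0 (\<lambda>t i. \<xi> t i \<omega>) t)"
  assumes "1 \<le> N"
    and distributions: "\<And>i. i \<in> {1..N} \<Longrightarrow> prob_space (D i)"
    and F_integrable: "\<And>i x. i \<in> {1..N} \<Longrightarrow> integrable (D i) (F i x)"
    and F_differentiable:
      "\<And>i x z. i \<in> {1..N} \<Longrightarrow> z \<in> space (D i) \<Longrightarrow> (\<lambda>y. F i y z) differentiable (at x)"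
    and unbiased:
      "\<And>i x. i \<in> {1..N} \<Longrightarrow>
        has_bochner_integral (D i) (\<lambda>z. gradient (\<lambda>y. F i y z) x) (gradient (f i) x)"
    and "0 < L" "0 < \<sigma>" "0 < \<kappa>"
    and smooth_differentiable: "\<And>i x. i \<in> {1..N} \<Longrightarrow> f i differentiable (at x)"
    and smooth_Lipschitz: "\<And>i. i \<in> {1..N} \<Longrightarrow> L-lipschitz_on UNIV (gradient (f i))"
    and variance_integrable:
      "\<And>i x. i \<in> {1..N} \<Longrightarrow>
        integrable (D i) (\<lambda>z. (norm (gradient (\<lambda>y. F i y z) x - gradient (f i) x))\<^sup>2)"
    and variance_bound:
      "\<And>i x. i \<in> {1..N} \<Longrightarrow>
        (\<integral>z. (norm (gradient (\<lambda>y. F i y z) x - gradient (f i) x))\<^sup>2 \<partial>(D i)) \<le> \<sigma>\<^sup>2"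
    and dissimilarity_bound:
      "\<And>x. average N (\<lambda>i. (norm (gradient (f i) x - gradient fbar x))\<^sup>2) \<le> \<kappa>\<^sup>2"
    and "prob_space M"
    and samples_distr:
      "\<And>t i. i \<in> {1..N} \<Longrightarrow> distr M (D i) (\<xi> t i) = D i"
    and samples_indep:
      "prob_space.indep_vars M (\<lambda>(t, i). D i) (\<lambda>(t, i). \<xi> t i) (UNIV \<times> {1..N})"
    and minimum: "\<exists>x. fbar x = fstar" "\<And>x. fstar \<le> fbar x"
    and "0 \<le> \<beta>" "\<beta> < 1" "0 < \<gamma>" "1 \<le> I"
    and step_size: "\<gamma> \<le> (1 - \<beta>)\<^sup>2 / ((1 + \<beta>) * L)"
    and sync_interval: "real I \<le> (1 - \<beta>) / (6 * L * \<gamma>)"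
  shows "(\<forall>t. integrable M (\<lambda>\<omega>. (norm (gradient fbar (xbar t \<omega>)))\<^sup>2)) \<and>
    (\<forall>T\<ge>1. (\<Sum>t<T. \<integral>\<omega>. (norm (gradient fbar (xbar t \<omega>)))\<^sup>2 \<partial>M) / real T
      \<le> sgdm_bound L \<beta> (fbar x0 - fstar) N T I \<gamma> \<sigma> \<kappa>) \<and>
    sgdm_bound_rate L \<beta> (fbar x0 - fstar)"
proof -
  interpret pr_sgdm M N I D F \<xi> x0 L \<sigma> \<kappa> \<beta> \<gamma>
    by (rule pr_sgdm.intro[OF \<open>prob_space M\<close> pr_sgdm_axioms.intro])
      (fact assms[unfolded f_def fbar_def])+
  have xbar: "xbar t \<omega> = sample_path.xbar \<omega> t" for t \<omega>
    by (simp add: xbar_def mean_iterate_def x_def)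
  have "integrable M (\<lambda>\<omega>. (norm (gradient fbar (xbar t \<omega>)))\<^sup>2)" for t
    unfolding xbar fbar_def
    by (intro square_integrable_norm_square square_integrable_global_gradient square_integrable_xbar)
  moreover have "(\<Sum>t<T. \<integral>\<omega>. (norm (gradient fbar (xbar t \<omega>)))\<^sup>2 \<partial>M) / real T
      \<le> sgdm_bound L \<beta> (fbar x0 - fstar) N T I \<gamma> \<sigma> \<kappa>" if "1 \<le> T" for T
    using average_gradient_norm_le[OF step_size sync_interval minimum(2)[unfolded fbar_def] that]
    unfolding xbar fbar_def .
  moreover have "sgdm_bound_rate L \<beta> (fbar x0 - fstar)"
    using \<open>0 < L\<close> \<open>\<beta> < 1\<close> by (rule sgdm_bound_rate_holds)
  ultimately show ?thesis by blast
qed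

end
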